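(* For the two-dimensional Euler equations with gravitational potential $\phi(x,y)$, the modified semi-discrete CDG schemes (on the primal and dual rectangular meshes) are well-balanced for the stationary hydrostatic solution. That is, for a stationary hydrostatic solution $(\rho^s,0,0,p^s)$ with $\nabla p^s=-\rho^s\nabla\phi$, and with $\mathbf U_h^{s,C},\mathbf U_h^{s,D}$ the projections of $\mathbf U^s=(\rho^s,0,0,p^s/(\gamma-1))^\top$, $$\mathbf L_h^C(\mathbf U_h^{s,C},\mathbf U_h^{s,D})=\mathbf 0,\qquad \mathbf L_h^D(\mathbf U_h^{s,D},\mathbf U_h^{s,C})=\mathbf 0 .$$
   Context: **Equations.** $\mathbf U_t+\nabla\cdot\mathbf F(\mathbf U)=\mathbf S(\mathbf U,\nabla\phi)$, $\mathbf U=(\rho,\mathbf m,E)^\top=(\rho,\rho u_1,\rho u_2,E)^\top$, $\mathbf F=(\mathbf F_1,\mathbf F_2)$, $\mathbf F_1=(\rho u_1,\rho u_1^2+p,\rho u_1u_2,(E+p)u_1)^\top$, $\mathbf F_2=(\rho u_2,\rho u_1u_2,\rho u_2^2+p,(E+p)u_2)^\top$, $\mathbf S=(0,-\rho\phi_x,-\rho\phi_y,-\mathbf m\cdot\nabla\phi)^\top$, with the ideal equation of state $p=(\gamma-1)(E-\frac{|\mathbf m|^2}{2\rho})$, $\gamma>1$. A stationary hydrostatic solution is $\{\rho^s(x,y),u_1^s(x,y),u_2^s(x,y),p^s(x,y)\}$ with $u_1^s=u_2^s=0$ and $\nabla p^s=-\rho^s\nabla\phi$; it is assumed known. **Meshes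 and spaces.** Uniform grids $x_a,y_b$ on a rectangular domain $\Omega$, with $a,b$ integers or half-integers, $x_{a+\frac12}-x_a=\Delta x/2$, $y_{b+\frac12}-y_b=\Delta y/2$; $I_{a,b}=(x_{a-\frac12},x_{a+\frac12})\times(y_{b-\frac12},y_{b+\frac12})$. Cells $I_{i,j}$ with integer indices form the primal mesh (label $C$), cells $I_{i+\frac12,j+\frac12}$ the dual mesh (label $D$). $\mathbb V_h^{C,k},\mathbb V_h^{D,k}$ are the spaces of functions which on each primal, respectively dual, cell are polynomials in $(x,y)$ of degree at most $k$; $\mathbb P^k(I_{a,b})$ is the space of such polynomials on $I_{a,b}$. For a cell $I_{a,b}$ write $(A,B)=(C,D)$ if $(a,b)$ are integers and $(A,B)=(D,C)$ if both are half-integers. $\overline{(g)}_{ab}=\frac1{\Delta x\Delta y}\int_{I_{a,b}}g\,dxdy$. **Projection.** The four quarter cells of $I_{a,b}$ are $I^0_{a,b}=(x_{a-\frac12},x_a)\times(y_{b-\frac12},y_b)$, $I^1_{a,b}=(x_a,x_{a+\frac12})\times(y_{b-\frac12},y_b)$, $I^2_{a,b}=(x_{a-\frac12},x_a)\times(y_b,y_{b+\frac12})$, $I^3_{a,b}=(x_a,x_{a+\frac12})\times(y_b,y_{b+\frac12})$. Let $\xi=2(x-x_a)/\Delta x$, $\eta=2(y-y_b)/\Delta y$, and let $\Phi_0=1,\Phi_1=\xi,\Phi_2=\eta,\Phi_3=\xi\eta,\Phi_4=\xi^2-\frac13,\Phi_5=\eta^2-\frac13,\dots,\Phi_K$ ($K=k(k+3)/2$)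 be the orthogonal (scaled Legendre) basis of $\mathbb P^k(I_{a,b})$. For $f\in L^2(\Omega)$, $\mathcal P_h^A(f)\in\mathbb V_h^{A,k}$ is defined on each cell of mesh $A$ by $\int_{I^m_{a,b}}\mathcal P_h^A(f)=\int_{I^m_{a,b}}f$ for $m=0,1,2$ and $\int_{I_{a,b}}\mathcal P_h^A(f)v=\int_{I_{a,b}}fv$ for all $v\in\mathrm{span}\{\Phi_0,\Phi_4,\dots,\Phi_K\}$ (so that the first identity also holds for $m=3$). $\mathbf U_h^{s,A}$ is the componentwise projection of $\mathbf U^s=(\rho^s,0,0,p^s/(\gamma-1))^\top$; $\rho_h^{s,A}=\mathcal P_h^A(\rho^s)$, $p_h^{s,A}=\mathcal P_h^A(p^s)$. **Quadrature.** $x_a^{1,\alpha},x_a^{2,\alpha}$ ($1\le\alpha\le N$) are the $N$-point Gauss nodes in $[x_{a-\frac12},x_a]$, $[x_a,x_{a+\frac12}]$, and $y_b^{1,\mu},y_b^{2,\mu}$ those in $[y_{b-\frac12},y_b]$, $[y_b,y_{b+\frac12}]$, with weights $\omega_\alpha$, $\sum_\alpha\omega_\alpha=1$, $N\ge k+1$. Sums over $\kappa,\sigma$ run over $\{1,2\}$ and over $\alpha,\mu$ over $\{1,\dots,N\}$. Define $$\delta^x_{ab}(f)=\sum_{\kappa,\alpha}\frac{\omega_\alpha}2\big(f(x_{a+\frac12},y_b^{\kappa,\alpha})-f(x_{a-\frac12},y_b^{\kappa,\alpha})\big),\quad \delta^y_{ab}(f)=\sum_{\kappa,\alpha}\frac{\omega_\alpha}2\big(f(x_a^{\kappa,\alpha},y_{b+\frac12})-f(x_a^{\kappa,\alpha},y_{b-\frac12})\big),$$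 where test functions are evaluated on $\partial I_{a,b}$ by limits from inside $I_{a,b}$. **Source discretization.** Let $\mathbf Q=(\mathbf Q_1,\mathbf Q_2)$, $\mathbf Q_1=(0,\rho,0,\rho u_1)^\top$, $\mathbf Q_2=(0,0,\rho,\rho u_2)^\top$ (a $4\times2$ matrix acting on vectors in $\mathbb R^2$), and let $\mathbf Q_h^B$ be $\mathbf Q$ formed from the components of $\mathbf U_h^B$. Let $\mathbf R=\overline{(\mathbf Q_h^B)}_{ab}/\overline{(\rho_h^{s,B})}_{ab}$ and $z=(x_a^{\kappa,\alpha},y_b^{\sigma,\mu})$. Then $$\langle\mathbf S_h^B,v\rangle_{ab}=\frac{\Delta x\Delta y}4\sum_{\kappa,\alpha}\sum_{\sigma,\mu}\omega_\alpha\omega_\mu\Big[\Big(\frac{\mathbf Q_h^B(z)}{\rho_h^{s,B}(z)}-\mathbf R\Big)(v\nabla p_h^{s,B})(z)-\mathbf R\,(p_h^{s,B}\nabla v)(z)\Big]+\mathbf R\begin{pmatrix}\Delta y\,\delta^x_{ab}(p_h^{s,B}v)\\ \Delta x\,\delta^y_{ab}(p_h^{s,B}v)\end{pmatrix}.$$ **Scheme.** For $\mathbf U_h^C\in[\mathbb V_h^{C,k}]^4$, $\mathbf U_h^D\in[\mathbb V_h^{D,k}]^4$, and $\tau_{max}>0$ (the maximal time step allowed by the CFL restriction), the operator $\mathbf L_h^A(\mathbf U_h^A,\mathbf U_h^B)\in[\mathbb V_h^{A,k}]^4$ is defined by: for each cell $I_{a,b}$ of mesh $A$ and each $v\in\mathbb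 P^k(I_{a,b})$, $$\int_{I_{a,b}}\mathbf L_h^A(\mathbf U_h^A,\mathbf U_h^B)v=\frac1{\tau_{max}}\int_{I_{a,b}}(\mathbf U_h^B-\mathbf U_h^A)v+\frac1{\tau_{max}}\int_{I_{a,b}}(\mathbf U_h^{s,A}-\mathbf U_h^{s,B})v+\langle\mathbf S_h^B,v\rangle_{ab}$$ $$+\frac{\Delta x\Delta y}4\sum_{\kappa,\alpha}\sum_{\sigma,\mu}\omega_\alpha\omega_\mu\big(\mathbf F_1(\mathbf U_h^B)v_x+\mathbf F_2(\mathbf U_h^B)v_y\big)(z)-\Delta y\,\delta^x_{ab}(\mathbf F_1(\mathbf U_h^B)v)-\Delta x\,\delta^y_{ab}(\mathbf F_2(\mathbf U_h^B)v).$$ The semi-discrete schemes are $\frac{d}{dt}\mathbf U_h^C=\mathbf L_h^C(\mathbf U_h^C,\mathbf U_h^D)$, $\frac{d}{dt}\mathbf U_h^D=\mathbf L_h^D(\mathbf U_h^D,\mathbf U_h^C)$. They are called well-balanced for $\mathbf U^s$ if, for initial data $\mathbf U_h^C(\cdot,0)=\mathbf U_h^{s,C}$, $\mathbf U_h^D(\cdot,0)=\mathbf U_h^{s,D}$, the flux and source term approximations balance each other, namely $\mathbf L_h^C(\mathbf U_h^{s,C},\mathbf U_h^{s,D})=\mathbf 0$ and $\mathbf L_h^D(\mathbf U_h^{s,D},\mathbf U_h^{s,C})=\mathbf 0$. *)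

theory Defs
  imports "HOL-Analysis.Analysis" "HOL-Computational_Algebra.Polynomial"
begin

section \<open>Euler equations with a gravitational potential\<close>

text \<open>
  Conserved variables are \<open>U = (\<rho>, m\<^sub>1, m\<^sub>2, E)\<close>, with velocity \<open>u\<^sub>i = m\<^sub>i / \<rho>\<close>.
\<close>

definition pressure :: "real \<Rightarrow> real^4 \<Rightarrow> real" where
  "pressure \<gamma> U = (\<gamma> - 1) * (U $ 4 - ((U $ 2)\<^sup>2 + (U $ 3)\<^sup>2) / (2 * U $ 1))"

definition flux1 :: "real \<Rightarrow> real^4 \<Rightarrow> real^4" where
  "flux1 \<gamma> U = (let \<rho> = U $ 1; u1 = U $ 2 / \<rho>; u2 = U $ 3 / \<rho>; E = U $ 4; p = pressure \<gamma> U
     in vector [\<rho> * u1, \<rho> * u1\<^sup>2 + p, \<rho> * u1 * u2, (E + p) * u1])"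

definition flux2 :: "real \<Rightarrow> real^4 \<Rightarrow> real^4" where
  "flux2 \<gamma> U = (let \<rho> = U $ 1; u1 = U $ 2 / \<rho>; u2 = U $ 3 / \<rho>; E = U $ 4; p = pressure \<gamma> U
     in vector [\<rho> * u2, \<rho> * u1 * u2, \<rho> * u2\<^sup>2 + p, (E + p) * u2])"

text \<open>
  The \<open>4 \<times> 2\<close> matrix with \<open>S(U, \<nabla>\<phi>) = - Q(U) \<nabla>\<phi>\<close>; its last row is \<open>(\<rho> u\<^sub>1, \<rho> u\<^sub>2) = (m\<^sub>1, m\<^sub>2)\<close>.
\<close>

definition Qmat :: "real^4 \<Rightarrow> real^2^4" where
  "Qmat U = vector [vector [0, 0], vector [U $ 1, 0], vector [0, U $ 1], vector [U $ 2, U $ 3]]"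

text \<open>
  Hydrostatic state: zero velocity, positive density and \<open>\<nabla>p\<^sup>s = - \<rho>\<^sup>s \<nabla>\<phi>\<close> pointwise in \<open>\<Omega>\<close>.
\<close>

definition hydrostatic ::
    "(real \<times> real) set \<Rightarrow> (real \<times> real \<Rightarrow> real) \<Rightarrow> (real \<times> real \<Rightarrow> real) \<Rightarrow> (real \<times> real \<Rightarrow> real) \<Rightarrow> bool"
  where "hydrostatic \<Omega> \<phi> \<rho>s ps \<longleftrightarrow>
    (\<forall>z\<in>\<Omega>. \<rho>s z > 0 \<and> (\<exists>g. (GDERIV \<phi> z :> g) \<and> (GDERIV ps z :> - \<rho>s z *\<^sub>R g)))"

definition Us :: "real \<Rightarrow> (real \<times> real \<Rightarrow> real) \<Rightarrow> (real \<times> real \<Rightarrow> real) \<Rightarrow> real \<times> real \<Rightarrow> real^4" where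
  "Us \<gamma> \<rho>s ps z = vector [\<rho>s z, 0, 0, ps z / (\<gamma> - 1)]"

definition L2_on :: "(real \<times> real) set \<Rightarrow> (real \<times> real \<Rightarrow> real) \<Rightarrow> bool" where
  "L2_on \<Omega> f \<longleftrightarrow> set_borel_measurable lborel \<Omega> f \<and> set_integrable lborel \<Omega> (\<lambda>z. (f z)\<^sup>2)"


section \<open>Legendre polynomials and Gauss quadrature\<close>

text \<open>
  Monic Legendre polynomials (Rodrigues' formula): \<open>1, X, X\<^sup>2 - 1/3, \<dots>\<close>
\<close>

definition legendre :: "nat \<Rightarrow> real poly" where
  "legendre n = smult (fact n / fact (2 * n)) ((pderiv ^^ n) ([:-1, 0, 1:] ^ n))"

text \<open>
  Nodes of the \<open>N\<close>-point Gauss rule on \<open>[-1, 1]\<close>, in increasing order and numbered from \<open>1\<close>.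
  The weights are the interpolatory ones, scaled by \<open>1/2\<close> so that they sum to \<open>1\<close>.
\<close>

definition gauss_node :: "nat \<Rightarrow> nat \<Rightarrow> real" where
  "gauss_node N \<alpha> = sorted_list_of_set {x. poly (legendre N) x = 0} ! (\<alpha> - 1)"

definition gauss_weight :: "nat \<Rightarrow> nat \<Rightarrow> real" where
  "gauss_weight N \<alpha> = (1 / 2) * integral {-1..1}
     (\<lambda>x. \<Prod>\<beta>\<in>{1..N} - {\<alpha>}. (x - gauss_node N \<beta>) / (gauss_node N \<alpha> - gauss_node N \<beta>))"


section \<open>Overlapping meshes\<close>

text \<open>
  The discretization parameters: the grid is \<open>x\<^sub>a = xorig + a hx\<close>, \<open>y\<^sub>b = yorig + b hy\<close>
  (so \<open>hx = \<Delta>x\<close>, \<open>hy = \<Delta>y\<close>), \<open>deg = k\<close>, \<open>ngauss = N\<close>, \<open>gam = \<gamma>\<close>, \<open>tmax = \<tau>\<^sub>m\<^sub>a\<^sub>x\<close>.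
\<close>

record cdg =
  xorig :: real
  yorig :: real
  hx :: real
  hy :: real
  deg :: nat
  ngauss :: nat
  gam :: real
  tmax :: real

definition gx :: "cdg \<Rightarrow> real \<Rightarrow> real" where "gx G a = xorig G + a * hx G"

definition gy :: "cdg \<Rightarrow> real \<Rightarrow> real" where "gy G b = yorig G + b * hy G"

datatype mesh_label = C | D

fun other :: "mesh_label \<Rightarrow> mesh_label" where
  "other C = D"
| "other D = C"

text \<open>
  Cell indices are real numbers: both integers on the primal mesh, both half-integers on the
  dual one.
\<close>

fun mesh :: "mesh_label \<Rightarrow> (real \<times> real) set" where
  "mesh C = {(a, b). a \<in> \<int> \<and> b \<in> \<int>}"
| "mesh D = {(a, b). a - 1/2 \<in> \<int> \<and> b - 1/2 \<in> \<int>}"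

definition cell :: "cdg \<Rightarrow> real \<Rightarrow> real \<Rightarrow> (real \<times> real) set" where
  "cell G a b = {gx G (a - 1/2)<..<gx G (a + 1/2)} \<times> {gy G (b - 1/2)<..<gy G (b + 1/2)}"

fun quarter :: "cdg \<Rightarrow> real \<Rightarrow> real \<Rightarrow> nat \<Rightarrow> (real \<times> real) set" where
  "quarter G a b m =
     (if even m then {gx G (a - 1/2)<..<gx G a} else {gx G a<..<gx G (a + 1/2)}) \<times>
     (if m < 2 then {gy G (b - 1/2)<..<gy G b} else {gy G b<..<gy G (b + 1/2)})"

text \<open>
  The scheme on the cell with index \<open>(a, b)\<close> uses the four cells of the other mesh that overlap it.
  \<open>stencil_cells\<close> selects the cells of a mesh for which these four lie in \<open>\<Omega>\<close>, the set on which
  the hydrostatic state is given.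
\<close>

definition stencil :: "cdg \<Rightarrow> real \<Rightarrow> real \<Rightarrow> (real \<times> real) set" where
  "stencil G a b = (\<Union>s\<in>{-1/2, 1/2}. \<Union>t\<in>{-1/2, 1/2}. cell G (a + s) (b + t))"

definition stencil_cells :: "cdg \<Rightarrow> (real \<times> real) set \<Rightarrow> mesh_label \<Rightarrow> (real \<times> real) set" where
  "stencil_cells G \<Omega> A = {(a, b) \<in> mesh A. stencil G a b \<subseteq> \<Omega>}"

text \<open>
  The discontinuous function on mesh \<open>A\<close> that equals \<open>q a b\<close> on the (open) cell with index
  \<open>(a, b)\<close>.  It is given the value \<open>0\<close> on the cell edges, where it has no value of its own.
\<close>

definition piecewise ::
    "cdg \<Rightarrow> mesh_label \<Rightarrow> (real \<Rightarrow> real \<Rightarrow> real \<times> real \<Rightarrow> 'a::zero) \<Rightarrow> real \<times> real \<Rightarrow> 'a" where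
  "piecewise G A q z =
     (if \<exists>(a, b)\<in>mesh A. z \<in> cell G a b
      then let (a, b) = (THE (a, b). (a, b) \<in> mesh A \<and> z \<in> cell G a b) in q a b z
      else 0)"


section \<open>Polynomial spaces and the projection\<close>

text \<open>
  A polynomial on a cell is identified with its extension to the plane.  In particular its
  limits from inside at the cell boundary are just its values there.
\<close>

definition polys :: "nat \<Rightarrow> (real \<times> real \<Rightarrow> real) set" where
  "polys k = {f. \<exists>c. \<forall>x y. f (x, y) = (\<Sum>i\<le>k. \<Sum>j\<le>k - i. c i j * x ^ i * y ^ j)}"

text \<open>
  The scaled Legendre basis \<open>\<Phi>\<^sub>0, \<dots>, \<Phi>\<^sub>K\<close> of a cell, indexed by the pairs \<open>(i, j)\<close> with
  \<open>i + j \<le> k\<close>: \<open>\<Phi>\<^sub>0, \<dots>, \<Phi>\<^sub>5\<close> are \<open>(0,0), (1,0), (0,1), (1,1), (2,0), (0,2)\<close>.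
  \<open>test_space\<close> is the span of \<open>\<Phi>\<^sub>0, \<Phi>\<^sub>4, \<dots>, \<Phi>\<^sub>K\<close>.
\<close>

definition basis_fun :: "cdg \<Rightarrow> real \<Rightarrow> real \<Rightarrow> nat \<times> nat \<Rightarrow> real \<times> real \<Rightarrow> real" where
  "basis_fun G a b = (\<lambda>(i, j) (x, y).
     poly (legendre i) (2 * (x - gx G a) / hx G) * poly (legendre j) (2 * (y - gy G b) / hy G))"

definition test_space :: "cdg \<Rightarrow> real \<Rightarrow> real \<Rightarrow> (real \<times> real \<Rightarrow> real) set" where
  "test_space G a b =
     {v. \<exists>c. \<forall>z. v z = (\<Sum>l\<in>{(i, j). i + j \<le> deg G} - {(1, 0), (0, 1), (1, 1)}.
                          c l * basis_fun G a b l z)}"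

definition proj_cell ::
    "cdg \<Rightarrow> (real \<times> real \<Rightarrow> real) \<Rightarrow> real \<Rightarrow> real \<Rightarrow> real \<times> real \<Rightarrow> real" where
  "proj_cell G f a b = (THE q. q \<in> polys (deg G) \<and>
     (\<forall>m\<in>{0, 1, 2}. (LINT z:quarter G a b m|lborel. q z) = (LINT z:quarter G a b m|lborel. f z)) \<and>
     (\<forall>v\<in>test_space G a b.
        (LINT z:cell G a b|lborel. q z * v z) = (LINT z:cell G a b|lborel. f z * v z)))"

definition proj :: "cdg \<Rightarrow> mesh_label \<Rightarrow> (real \<times> real \<Rightarrow> real) \<Rightarrow> real \<times> real \<Rightarrow> real" where
  "proj G A f = piecewise G A (proj_cell G f)"

definition Ush ::
    "cdg \<Rightarrow> mesh_label \<Rightarrow> (real \<times> real \<Rightarrow> real) \<Rightarrow> (real \<times> real \<Rightarrow> real) \<Rightarrow> real \<times> real \<Rightarrow> real^4" where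
  "Ush G A \<rho>s ps z = (\<chi> i. proj G A (\<lambda>w. Us (gam G) \<rho>s ps w $ i) z)"


section \<open>Quadrature on a cell\<close>

text \<open>
  \<open>half_node c h N \<kappa> \<alpha>\<close> is the \<open>\<alpha>\<close>-th Gauss node in \<open>[c - h/2, c]\<close> (\<open>\<kappa> = 1\<close>) or in
  \<open>[c, c + h/2]\<close> (\<open>\<kappa> = 2\<close>).
\<close>

definition half_node :: "real \<Rightarrow> real \<Rightarrow> nat \<Rightarrow> nat \<Rightarrow> nat \<Rightarrow> real" where
  "half_node c h N \<kappa> \<alpha> = c + (if \<kappa> = 1 then - (h / 4) else h / 4) + (h / 4) * gauss_node N \<alpha>"

definition xnode :: "cdg \<Rightarrow> real \<Rightarrow> nat \<Rightarrow> nat \<Rightarrow> real" where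
  "xnode G a \<kappa> \<alpha> = half_node (gx G a) (hx G) (ngauss G) \<kappa> \<alpha>"

definition ynode :: "cdg \<Rightarrow> real \<Rightarrow> nat \<Rightarrow> nat \<Rightarrow> real" where
  "ynode G b \<sigma> \<mu> = half_node (gy G b) (hy G) (ngauss G) \<sigma> \<mu>"

definition quad_sum :: "cdg \<Rightarrow> real \<Rightarrow> real \<Rightarrow> (real \<times> real \<Rightarrow> 'a::real_vector) \<Rightarrow> 'a" where
  "quad_sum G a b f = (hx G * hy G / 4) *\<^sub>R
     (\<Sum>\<kappa>\<in>{1, 2}. \<Sum>\<alpha>=1..ngauss G. \<Sum>\<sigma>\<in>{1, 2}. \<Sum>\<mu>=1..ngauss G.
        (gauss_weight (ngauss G) \<alpha> * gauss_weight (ngauss G) \<mu>) *\<^sub>R f (xnode G a \<kappa> \<alpha>, ynode G b \<sigma> \<mu>))"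

definition delta_x :: "cdg \<Rightarrow> real \<Rightarrow> real \<Rightarrow> (real \<times> real \<Rightarrow> 'a::real_vector) \<Rightarrow> 'a" where
  "delta_x G a b f = (\<Sum>\<kappa>\<in>{1, 2}. \<Sum>\<alpha>=1..ngauss G. (gauss_weight (ngauss G) \<alpha> / 2) *\<^sub>R
     (f (gx G (a + 1/2), ynode G b \<kappa> \<alpha>) - f (gx G (a - 1/2), ynode G b \<kappa> \<alpha>)))"

definition delta_y :: "cdg \<Rightarrow> real \<Rightarrow> real \<Rightarrow> (real \<times> real \<Rightarrow> 'a::real_vector) \<Rightarrow> 'a" where
  "delta_y G a b f = (\<Sum>\<kappa>\<in>{1, 2}. \<Sum>\<alpha>=1..ngauss G. (gauss_weight (ngauss G) \<alpha> / 2) *\<^sub>R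
     (f (xnode G a \<kappa> \<alpha>, gy G (b + 1/2)) - f (xnode G a \<kappa> \<alpha>, gy G (b - 1/2))))"

definition cell_avg ::
    "cdg \<Rightarrow> real \<Rightarrow> real \<Rightarrow> (real \<times> real \<Rightarrow> 'a::{banach, second_countable_topology}) \<Rightarrow> 'a" where
  "cell_avg G a b f = (1 / (hx G * hy G)) *\<^sub>R (LINT z:cell G a b|lborel. f z)"

definition partial_x :: "(real \<times> real \<Rightarrow> real) \<Rightarrow> real \<times> real \<Rightarrow> real" where
  "partial_x f z = deriv (\<lambda>x. f (x, snd z)) (fst z)"

definition partial_y :: "(real \<times> real \<Rightarrow> real) \<Rightarrow> real \<times> real \<Rightarrow> real" where
  "partial_y f z = deriv (\<lambda>y. f (fst z, y)) (snd z)"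

definition grad :: "(real \<times> real \<Rightarrow> real) \<Rightarrow> real \<times> real \<Rightarrow> real^2" where
  "grad f z = vector [partial_x f z, partial_y f z]"


section \<open>The central discontinuous Galerkin scheme\<close>

text \<open>
  In \<open>source_form\<close>, \<open>\<rho>h\<close>, \<open>ph\<close> and \<open>UB\<close> live on the mesh other than that of the cell.
\<close>

definition source_form ::
    "cdg \<Rightarrow> (real \<times> real \<Rightarrow> real) \<Rightarrow> (real \<times> real \<Rightarrow> real) \<Rightarrow> (real \<times> real \<Rightarrow> real^4) \<Rightarrow>
     real \<Rightarrow> real \<Rightarrow> (real \<times> real \<Rightarrow> real) \<Rightarrow> real^4" where
  "source_form G \<rho>h ph UB a b v =
     (let R = (1 / cell_avg G a b \<rho>h) *\<^sub>R cell_avg G a b (\<lambda>z. Qmat (UB z)) in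
      quad_sum G a b (\<lambda>z.
        ((1 / \<rho>h z) *\<^sub>R Qmat (UB z) - R) *v (v z *\<^sub>R grad ph z) - R *v (ph z *\<^sub>R grad v z))
      + R *v vector [hy G * delta_x G a b (\<lambda>z. ph z * v z),
                     hx G * delta_y G a b (\<lambda>z. ph z * v z)])"

definition scheme_form ::
    "cdg \<Rightarrow> mesh_label \<Rightarrow> (real \<times> real \<Rightarrow> real) \<Rightarrow> (real \<times> real \<Rightarrow> real) \<Rightarrow>
     (real \<times> real \<Rightarrow> real^4) \<Rightarrow> (real \<times> real \<Rightarrow> real^4) \<Rightarrow>
     real \<Rightarrow> real \<Rightarrow> (real \<times> real \<Rightarrow> real) \<Rightarrow> real^4" where
  "scheme_form G A \<rho>s ps UA UB a b v =
     (1 / tmax G) *\<^sub>R (LINT z:cell G a b|lborel. v z *\<^sub>R (UB z - UA z))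
     + (1 / tmax G) *\<^sub>R
         (LINT z:cell G a b|lborel. v z *\<^sub>R (Ush G A \<rho>s ps z - Ush G (other A) \<rho>s ps z))
     + source_form G (proj G (other A) \<rho>s) (proj G (other A) ps) UB a b v
     + quad_sum G a b (\<lambda>z.
         partial_x v z *\<^sub>R flux1 (gam G) (UB z) + partial_y v z *\<^sub>R flux2 (gam G) (UB z))
     - hy G *\<^sub>R delta_x G a b (\<lambda>z. v z *\<^sub>R flux1 (gam G) (UB z))
     - hx G *\<^sub>R delta_y G a b (\<lambda>z. v z *\<^sub>R flux2 (gam G) (UB z))"

text \<open>
  \<open>Lh G A \<rho>s ps UA UB\<close> is \<open>L\<^sub>h\<^sup>A(U\<^sub>h\<^sup>A, U\<^sub>h\<^sup>B)\<close> for the other mesh \<open>B\<close>.  It also depends on the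
  hydrostatic state \<open>(\<rho>s, ps)\<close> to which the scheme is tuned.
\<close>

definition Lh_cell ::
    "cdg \<Rightarrow> mesh_label \<Rightarrow> (real \<times> real \<Rightarrow> real) \<Rightarrow> (real \<times> real \<Rightarrow> real) \<Rightarrow>
     (real \<times> real \<Rightarrow> real^4) \<Rightarrow> (real \<times> real \<Rightarrow> real^4) \<Rightarrow>
     real \<Rightarrow> real \<Rightarrow> real \<times> real \<Rightarrow> real^4" where
  "Lh_cell G A \<rho>s ps UA UB a b = (THE q. (\<forall>i. (\<lambda>z. q z $ i) \<in> polys (deg G)) \<and>
     (\<forall>v\<in>polys (deg G).
        (LINT z:cell G a b|lborel. v z *\<^sub>R q z) = scheme_form G A \<rho>s ps UA UB a b v))"

definition Lh ::
    "cdg \<Rightarrow> mesh_label \<Rightarrow> (real \<times> real \<Rightarrow> real) \<Rightarrow> (real \<times> real \<Rightarrow> real) \<Rightarrow>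
     (real \<times> real \<Rightarrow> real^4) \<Rightarrow> (real \<times> real \<Rightarrow> real^4) \<Rightarrow> real \<times> real \<Rightarrow> real^4" where
  "Lh G A \<rho>s ps UA UB = piecewise G A (Lh_cell G A \<rho>s ps UA UB)"

end

theory Submission
  imports Defs
begin

text \<open>
  Along a state at rest the scheme reduces to one scalar function, the projected pressure
  \<open>p\<close> on the other mesh. The fluxes are then \<open>(0, p, 0, 0)\<close> and \<open>(0, 0, p, 0)\<close>, and \<open>Q(U)\<close> is the
  projected density \<open>\<rho>\<close> times the constant matrix that embeds a planar vector into the momentum
  components. The ratio of the cell averages of \<open>Q(U)\<close> and \<open>\<rho>\<close> is therefore this constant matrix,
  and it equals \<open>Q(U) / \<rho>\<close> at every node, where \<open>\<rho>\<close> is assumed not to vanish. So the part of the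
  source with \<open>v \<nabla>p\<close> vanishes, and what remains, \<open>- p \<nabla>v\<close> on the nodes and \<open>p v\<close> on the edges, is
  exactly the negative of the discretized flux. Both sides use the same nodes, weights and point
  values, hence they cancel term by term. The relaxation term and its hydrostatic correction cancel
  pointwise. All this is \<open>scheme_form_hydrostatic\<close>; that the operator itself vanishes follows because
  a polynomial of degree at most \<open>k\<close> that is orthogonal to all such polynomials is zero.

  Three facts make this reduction legitimate.

  \<^item> The projection is well defined and linear, so that the projections of \<open>p / (\<gamma> - 1)\<close> and of \<open>p\<close>
    are proportional and the projection of \<open>0\<close> is \<open>0\<close>. In the Legendre basis, which is orthogonal, the
    conditions against the test space fix all coefficients except those of \<open>\<xi>\<close>, \<open>\<eta>\<close>, \<open>\<xi>\<eta>\<close>, and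
    the three quarter cell integrals determine these (\<open>ex1_is_proj_cell\<close>).

  \<^item> The average of \<open>\<rho>\<close> over a cell is not zero. The projection preserves the integral over every
    quarter cell, and a cell consists of four quarters of cells of the other mesh, so that
    average is the average of the positive function \<open>\<rho>\<^sup>s\<close> (\<open>proj_other_mesh_integral_pos\<close>).

  \<^item> The quadrature points lie in the closed cell. A point of the closed cell is either in one of the
    four overlapping cells, where \<open>\<rho>\<^sup>s\<close> and \<open>p\<^sup>s\<close> are integrable, or on an edge, where a piecewise
    function is \<open>0\<close>. This needs the \<open>N\<close>-th Legendre polynomial to have \<open>N\<close> distinct real roots, all in
    \<open>(-1, 1)\<close>, which follows from Rodrigues' formula and Rolle's theorem (\<open>gauss_node_bounds\<close>).
\<close>


section \<open>Legendre polynomials and Gauss nodes\<close>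

abbreviation rodrigues :: "nat \<Rightarrow> nat \<Rightarrow> real poly" where
  "rodrigues n j \<equiv> (pderiv ^^ j) ([:-1, 0, 1:] ^ n)"

lemma degree_rodrigues: "degree (rodrigues n j) = 2 * n - j"
  by (simp add: degree_higher_pderiv degree_power_eq)

lemma degree_legendre [simp]: "degree (legendre n) = n"
  by (simp add: legendre_def degree_rodrigues)

lemma legendre_nonzero [simp]: "legendre n \<noteq> 0"
proof (cases "n = 0")
  case False
  then show ?thesis
    by (metis degree_0 degree_legendre)
qed (simp add: legendre_def)

lemma legendre_0 [simp]: "legendre 0 = 1"
  by (simp add: legendre_def)

lemma legendre_1 [simp]: "legendre (Suc 0) = [:0, 1:]"
  by (simp add: legendre_def pderiv_pCons fact_numeral)

lemma power_dvd_pderiv: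
  fixes a p :: "real poly"
  assumes "a ^ Suc m dvd p"
  shows "a ^ m dvd pderiv p"
proof -
  obtain q where "p = a ^ Suc m * q"
    using assms by (auto simp: dvd_def)
  then have "pderiv p = a ^ m * (a * pderiv q + smult (of_nat (Suc m)) (pderiv a * q))"
    by (simp only: pderiv_mult pderiv_power_Suc) (simp add: algebra_simps smult_add_right)
  then show ?thesis
    by simp
qed

text \<open>
  The points \<open>-1\<close> and \<open>1\<close> are zeros of order \<open>n\<close> of \<open>(X\<^sup>2 - 1)\<^sup>n\<close>, and each derivative lowers the
  order by one. These zeros supply the two end points for Rolle's theorem and kill the boundary
  terms of integration by parts.
\<close>

lemma rodrigues_endpoint:
  assumes "j < n" and "x = 1 \<or> x = -1"
  shows "poly (rodrigues n j) x = 0"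
proof -
  have "[:-1, 0, 1:] ^ (n - i) dvd rodrigues n i" if "i \<le> n" for i
    using that
  proof (induction i)
    case (Suc i)
    then show ?case
      by (auto intro!: power_dvd_pderiv simp: Suc_diff_Suc simp del: power_Suc)
  qed simp
  then have "[:-1, 0, 1:] ^ (n - j) dvd rodrigues n j"
    using assms by simp
  then obtain q where "rodrigues n j = [:-1, 0, 1:] ^ (n - j) * q"
    by (auto simp: dvd_def)
  then show ?thesis
    using assms by (auto simp: poly_power)
qed

text \<open>
  Rolle's theorem between consecutive zeros. The strict bounds let \<open>rodrigues_roots\<close> add the end points
  again at the next derivative.
\<close>

lemma roots_pderiv_between_roots:
  fixes p :: "real poly"
  assumes "finite T" and "card T = Suc m" and "\<And>x. x \<in> T \<Longrightarrow> poly p x = 0"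
  shows "\<exists>S. finite S \<and> card S = m \<and> (\<forall>x\<in>S. poly (pderiv p) x = 0 \<and> Min T < x \<and> x < Max T)"
  using assms
proof (induction m arbitrary: T)
  case 0
  then show ?case by (intro exI[of _ "{}"]) auto
next
  case (Suc m)
  have T: "finite T" "T \<noteq> {}"
    using Suc.prems by auto
  define M where "M = Max T"
  define T' where "T' = T - {M}"
  have M: "M \<in> T" "\<And>x. x \<in> T \<Longrightarrow> x \<le> M"
    using T by (auto simp: M_def)
  have T': "finite T'" "card T' = Suc m"
    using T Suc.prems M by (auto simp: T'_def)
  then have ne: "T' \<noteq> {}" by auto
  obtain S where S: "finite S" "card S = m"
      "\<forall>x\<in>S. poly (pderiv p) x = 0 \<and> Min T' < x \<and> x < Max T'"
    using Suc.IH[OF T'] Suc.prems(3) by (auto simp: T'_def)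
  define M' where "M' = Max T'"
  have M': "M' \<in> T'"
    using T' ne by (simp add: M'_def)
  then have "M' < M"
    using M(2)[of M'] by (auto simp: T'_def)
  then obtain x where x: "M' < x" "x < M" "poly p M - poly p M' = (M - M') * poly (pderiv p) x"
    using poly_MVT[of M' M p] by blast
  have "M' \<in> T" using M' by (simp add: T'_def)
  then have root: "poly (pderiv p) x = 0"
    using x Suc.prems(3) M(1) by auto
  have min: "Min T \<le> Min T'"
    using T T' ne by (intro Min_antimono) (auto simp: T'_def)
  have min': "Min T' \<le> M'"
    using T' M' by simp
  have "x \<notin> S"
    using S(3) x(1) by (force simp: M'_def)
  then show ?case
    using S x root min min' \<open>M' < M\<close>
    by (intro exI[of _ "insert x S"]) (force simp: M'_def[symmetric] M_def[symmetric])
qed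

lemma rodrigues_roots:
  assumes "j \<le> n"
  shows "\<exists>S. finite S \<and> card S = j \<and> S \<subseteq> {-1<..<1} \<and> (\<forall>x\<in>S. poly (rodrigues n j) x = 0)"
  using assms
proof (induction j)
  case (Suc j)
  then obtain S where S: "finite S" "card S = j" "S \<subseteq> {-1<..<1}"
      "\<forall>x\<in>S. poly (rodrigues n j) x = 0"
    by auto
  let ?T = "insert (-1) (insert 1 S)"
  have T: "finite ?T" "card ?T = Suc (Suc j)"
    using S by (auto simp: card_insert_if)
  have "poly (rodrigues n j) x = 0" if "x \<in> ?T" for x
    using that S rodrigues_endpoint[of j n x] Suc.prems by auto
  from roots_pderiv_between_roots[OF T this]
  obtain S' where S': "finite S'" "card S' = Suc j"
      "\<forall>x\<in>S'. poly (pderiv (rodrigues n j)) x = 0 \<and> Min ?T < x \<and> x < Max ?T"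
    by auto
  have "Min ?T = -1" "Max ?T = 1"
    using S by (intro Min_eqI Max_eqI; force)+
  then show ?case
    using S' by (intro exI[of _ S']) auto
qed (intro exI[of _ "{}"], auto)

lemma gauss_node_bounds:
  assumes "\<alpha> \<in> {1..N}"
  shows "gauss_node N \<alpha> \<in> {-1<..<1}"
proof -
  let ?R = "{x. poly (legendre N) x = 0}"
  obtain S where S: "finite S" "card S = N" "S \<subseteq> {-1<..<1}"
      "\<forall>x\<in>S. poly (rodrigues N N) x = 0"
    using rodrigues_roots[of N N] by auto
  have fin: "finite ?R"
    by (simp add: poly_roots_finite)
  have "S \<subseteq> ?R"
    using S by (auto simp: legendre_def)
  moreover have "card ?R \<le> N"
    using card_poly_roots_bound[of "legendre N"] by simp
  \<comment> \<open>Rolle gives as many zeros as the degree allows, so there are no others outside \<open>(-1, 1)\<close>,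
    and the index of the node stays within the list of zeros.\<close>
  ultimately have "?R = S"
    using S fin by (metis card_seteq)
  have "sorted_list_of_set S ! (\<alpha> - 1) \<in> set (sorted_list_of_set S)"
    using assms S by (intro nth_mem) auto
  then show ?thesis
    using S \<open>?R = S\<close> by (auto simp: gauss_node_def)
qed


section \<open>Integrals of polynomials over intervals\<close>

lemma poly_mult_eta: "poly (p * q) = (\<lambda>x. poly p x * poly q x)"
  by (simp add: fun_eq_iff)

lemma set_integrable_poly: "set_integrable lborel {l<..<u} (poly p)" for p :: "real poly"
  by (rule set_integrable_subset[of _ "{l..u}"])
     (auto intro!: borel_integrable_atLeastAtMost' continuous_intros)

lemma integral_pderiv:
  fixes p :: "real poly" and l u :: real
  assumes "l \<le> u"
  shows "(LINT x:{l<..<u}|lborel. poly (pderiv p) x) = poly p u - poly p l"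
proof -
  have "(LBINT x=ereal l..ereal u. poly (pderiv p) x) = poly p u - poly p l"
    by (rule interval_integral_FTC_finite)
       (auto intro!: continuous_intros has_real_derivative_iff_has_vector_derivative[THEN iffD1]
          DERIV_subset[OF poly_DERIV])
  then show ?thesis
    using assms by (simp add: interval_lebesgue_integral_def einterval_eq)
qed

text \<open>
  Integration by parts moves the derivatives one at a time onto \<open>q\<close>, whose degree is too
  small to survive.
\<close>

lemma rodrigues_orthogonal:
  assumes "j \<le> n" and "q = 0 \<or> degree q < j"
  shows "(LINT x:{-1<..<1}|lborel. poly (rodrigues n j * q) x) = 0"
  using assms
proof (induction j arbitrary: q)
  case (Suc j)
  let ?W = "rodrigues n j"
  have "pderiv ?W * q = pderiv (?W * q) - ?W * pderiv q"
    by (simp add: pderiv_mult algebra_simps)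
  then have "(LINT x:{-1<..<1}|lborel. poly (rodrigues n (Suc j) * q) x)
      = (LINT x:{-1<..<1}|lborel. poly (pderiv (?W * q)) x - poly (?W * pderiv q) x)"
    by simp
  also have "\<dots> = (LINT x:{-1<..<1}|lborel. poly (pderiv (?W * q)) x)
      - (LINT x:{-1<..<1}|lborel. poly (?W * pderiv q) x)"
    by (intro set_integral_diff set_integrable_poly)
  also have "(LINT x:{-1<..<1}|lborel. poly (pderiv (?W * q)) x) = 0"
    using rodrigues_endpoint[of j n 1] rodrigues_endpoint[of j n "-1"] Suc.prems
    by (subst integral_pderiv) auto
  also have "(LINT x:{-1<..<1}|lborel. poly (?W * pderiv q) x) = 0"
  proof (rule Suc.IH)
    show "pderiv q = 0 \<or> degree (pderiv q) < j"
      using Suc.prems by (cases "degree q = 0") (auto simp: pderiv_eq_0_iff degree_pderiv)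
  qed (use Suc.prems in simp)
  finally show ?case by simp
qed (simp add: set_lebesgue_integral_def)

lemma legendre_orthogonal:
  assumes "i \<noteq> j"
  shows "(LINT x:{-1<..<1}|lborel. poly (legendre i) x * poly (legendre j) x) = 0"
proof -
  have *: "(LINT x:{-1<..<1}|lborel. poly (legendre i) x * poly (legendre j) x) = 0" if "j < i" for i j
  proof -
    have "(LINT x:{-1<..<1}|lborel. fact i / fact (2 * i) * poly (rodrigues i i * legendre j) x) = 0"
      using rodrigues_orthogonal[of i i "legendre j"] that
      by (subst set_integral_mult_right) (simp add: poly_mult_eta)
    then show ?thesis
      by (simp add: legendre_def[of i] mult_ac)
  qed
  show ?thesis
    using *[of i j] *[of j i] assms by (cases "j < i") (auto simp: mult.commute)
qed

lemma legendre_norm_pos: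
  "(LINT x:{-1<..<1}|lborel. poly (legendre i) x * poly (legendre i) x) > 0"
proof -
  let ?f = "\<lambda>x. poly (legendre i) x * poly (legendre i) x"
  have int: "set_integrable lborel {-1<..<1} ?f"
    using set_integrable_poly[of "-1" 1 "legendre i * legendre i"] by (simp only: poly_mult_eta)
  have eq: "(LINT x:{-1<..<1}|lborel. ?f x) = integral {-1..1} ?f"
    using set_borel_integral_eq_integral(2)[OF int]
    by (simp add: integral_open_interval_real)
  have "integral {-1..1} ?f \<ge> 0"
    by (rule integral_nonneg) (auto intro!: integrable_continuous_interval continuous_intros)
  moreover have "integral {-1..1} ?f \<noteq> 0"
  proof
    assume "integral {-1..1} ?f = 0"
    then have "\<forall>x\<in>{-1..1}. ?f x = 0"
      by (subst (asm) integral_eq_0_iff) (auto intro!: continuous_intros)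
    then have "{-1..1} \<subseteq> {x. poly (legendre i) x = 0}"
      by auto
    then have "finite {-1..1::real}"
      by (rule finite_subset) (simp add: poly_roots_finite)
    then show False by (simp add: infinite_Icc)
  qed
  ultimately show ?thesis using eq by simp
qed

text \<open>
  The factor of a basis function of a cell in one variable, for an interval with centre \<open>c\<close> and
  length \<open>h\<close>.
\<close>

definition scaled_legendre :: "real \<Rightarrow> real \<Rightarrow> nat \<Rightarrow> real poly" where
  "scaled_legendre c h i = pcompose (legendre i) [:- (2 * c / h), 2 / h:]"

lemma poly_scaled_legendre:
  "poly (scaled_legendre c h i) x = poly (legendre i) (2 * (x - c) / h)"
  by (simp add: scaled_legendre_def poly_pcompose algebra_simps diff_divide_distrib)

lemma degree_scaled_legendre: "h \<noteq> 0 \<Longrightarrow> degree (scaled_legendre c h i) = i"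
  by (simp add: scaled_legendre_def degree_pcompose)

lemma integral_affine:
  fixes f :: "real \<Rightarrow> real"
  assumes "h > 0"
  shows "(LINT x:{c - h/2<..<c + h/2}|lborel. f (2 * (x - c) / h)) = h / 2 * (LINT x:{-1<..<1}|lborel. f x)"
proof -
  have ind: "indicator {c - h/2<..<c + h/2} (c + h/2 * x) = (indicator {-1<..<1} x :: real)" for x
  proof -
    have "h * (-1) < h * x \<longleftrightarrow> -1 < x"
      using assms by (rule mult_less_cancel_left_pos)
    then show ?thesis
      using assms by (simp add: indicator_def)
  qed
  have "(LINT x|lborel. indicator {c - h/2<..<c + h/2} x *\<^sub>R f (2 * (x - c) / h))
     = \<bar>h/2\<bar> *\<^sub>R (LINT x|lborel. indicator {c - h/2<..<c + h/2} (c + h/2 * x) *\<^sub>R f (2 * ((c + h/2 * x) - c) / h))"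
    using assms by (intro lborel_integral_real_affine) auto
  then show ?thesis
    unfolding ind using assms by (simp add: set_lebesgue_integral_def)
qed

lemma scaled_legendre_orthogonal:
  assumes "h > 0"
  shows "(LINT x:{c - h/2<..<c + h/2}|lborel. poly (scaled_legendre c h i) x * poly (scaled_legendre c h j) x) = 0
         \<longleftrightarrow> i \<noteq> j"
  using assms legendre_orthogonal[of i j] legendre_norm_pos[of i]
  by (subst poly_scaled_legendre, subst poly_scaled_legendre,
      subst integral_affine[where f = "\<lambda>x. poly (legendre i) x * poly (legendre j) x"]) auto

lemma half_moments:
  assumes "h > 0"
  shows "(LINT x:{c - h/2<..<c}|lborel. poly (scaled_legendre c h 0) x) = h / 2"
    and "(LINT x:{c - h/2<..<c}|lborel. poly (scaled_legendre c h (Suc 0)) x) = - (h / 4)"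
    and "(LINT x:{c<..<c + h/2}|lborel. poly (scaled_legendre c h 0) x) = h / 2"
    and "(LINT x:{c<..<c + h/2}|lborel. poly (scaled_legendre c h (Suc 0)) x) = h / 4"
proof -
  have 0: "scaled_legendre c h 0 = pderiv [:0, 1:]"
    by (simp add: scaled_legendre_def pderiv_pCons pcompose_1)
  \<comment> \<open>The antiderivative \<open>(x - c)\<^sup>2 / h\<close> of \<open>2 (x - c) / h\<close>.\<close>
  have 1: "scaled_legendre c h (Suc 0) = pderiv [:c\<^sup>2 / h, - (2 * c / h), 1 / h:]"
    by (simp add: scaled_legendre_def pderiv_pCons pcompose_pCons)
  show "(LINT x:{c - h/2<..<c}|lborel. poly (scaled_legendre c h 0) x) = h / 2"
    "(LINT x:{c<..<c + h/2}|lborel. poly (scaled_legendre c h 0) x) = h / 2"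
    unfolding 0 using assms by (simp_all only: integral_pderiv) (auto simp: integral_pderiv)
  show "(LINT x:{c - h/2<..<c}|lborel. poly (scaled_legendre c h (Suc 0)) x) = - (h / 4)"
    "(LINT x:{c<..<c + h/2}|lborel. poly (scaled_legendre c h (Suc 0)) x) = h / 4"
    unfolding 1 using assms 
    by (subst integral_pderiv; simp add: field_simps power2_eq_square)+
qed


section \<open>Integrals over rectangles\<close>

lemma set_integral_tensor:
  fixes f g :: "real \<Rightarrow> real"
  assumes "set_integrable lborel A f" and "set_integrable lborel B g"
  shows "set_integrable lborel (A \<times> B) (\<lambda>z. f (fst z) * g (snd z))"
    and "(LINT z:A \<times> B|lborel. f (fst z) * g (snd z)) = (LINT x:A|lborel. f x) * (LINT y:B|lborel. g y)"
proof -
  let ?f = "\<lambda>x. indicator A x * f x" and ?g = "\<lambda>y. indicator B y * g y"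
  let ?h = "\<lambda>z. ?f (fst z) * ?g (snd z)"
  have f: "integrable lborel ?f" and g: "integrable lborel ?g"
    using assms by (simp_all add: set_integrable_def)
  have [measurable]: "?f \<in> borel_measurable lborel" "?g \<in> borel_measurable lborel"
    using f g by auto
  have meas: "?h \<in> borel_measurable (lborel \<Otimes>\<^sub>M lborel)"
    by measurable
  have int: "integrable (lborel \<Otimes>\<^sub>M lborel) ?h"
  proof (rule lborel_pair.Fubini_integrable[OF meas])
    have "integrable lborel (\<lambda>x. norm (?f x) * (LINT y|lborel. norm (?g y)))"
      using f by (intro integrable_mult_left integrable_norm) auto
    then show "integrable lborel (\<lambda>x. LINT y|lborel. norm (?h (x, y)))"
      by (simp add: abs_mult)
    show "AE x in lborel. integrable lborel (\<lambda>y. ?h (x, y))"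
      using g by (intro AE_I2) simp
  qed
  have eq: "indicator (A \<times> B) z *\<^sub>R (f (fst z) * g (snd z)) = ?h z" for z
    by (cases z) (auto simp: indicator_def)
  show "set_integrable lborel (A \<times> B) (\<lambda>z. f (fst z) * g (snd z))"
    unfolding set_integrable_def eq using int by (simp add: lborel_prod)
  have "(LINT x|lborel. LINT y|lborel. ?h (x, y)) = integral\<^sup>L (lborel \<Otimes>\<^sub>M lborel) ?h"
    by (rule lborel_pair.integral_fst'[OF int])
  then have "integral\<^sup>L lborel ?h = (LINT x|lborel. LINT y|lborel. ?f x * ?g y)"
    by (simp add: lborel_prod)
  then show "(LINT z:A \<times> B|lborel. f (fst z) * g (snd z)) = (LINT x:A|lborel. f x) * (LINT y:B|lborel. g y)"
    unfolding set_lebesgue_integral_def eq by simp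
qed

lemma set_integrable_mult_bounded:
  fixes f g :: "'a::euclidean_space \<Rightarrow> real"
  assumes "set_integrable lborel S f" and "continuous_on UNIV g" and "bounded S"
  shows "set_integrable lborel S (\<lambda>z. f z * g z)"
proof -
  have "compact (closure S)"
    using assms by auto
  then have "bounded (g ` closure S)"
    using assms(2) by (intro compact_imp_bounded compact_continuous_image) (auto intro: continuous_on_subset)
  then obtain K where K: "\<And>z. z \<in> S \<Longrightarrow> \<bar>g z\<bar> \<le> K"
    using closure_subset[of S] by (force simp: bounded_iff)
  have g: "g \<in> borel_measurable borel"
    using assms(2) by (rule borel_measurable_continuous_onI)
  have f: "integrable lborel (\<lambda>z. indicator S z * f z)"
    using assms(1) by (simp add: set_integrable_def)
  have "integrable lborel (\<lambda>z. (indicator S z * f z) * g z)"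
  proof (rule Bochner_Integration.integrable_bound)
    show "integrable lborel (\<lambda>z. K * (indicator S z * f z))"
      using f by simp
    show "(\<lambda>z. (indicator S z * f z) * g z) \<in> borel_measurable lborel"
      using f g by measurable
    show "AE z in lborel. norm ((indicator S z * f z) * g z) \<le> norm (K * (indicator S z * f z))"
    proof (intro AE_I2)
      fix z
      show "norm ((indicator S z * f z) * g z) \<le> norm (K * (indicator S z * f z))"
      proof (cases "z \<in> S")
        case True
        then have "\<bar>g z\<bar> \<le> \<bar>K\<bar>" using K[of z] by simp
        then show ?thesis
          using True by (simp add: abs_mult mult.commute[of _ "\<bar>g z\<bar>"] mult_right_mono)
      qed simp
    qed
  qed
  then show ?thesis
    by (simp add: set_integrable_def mult.assoc)
qed

lemma set_integral_finite_sum: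
  fixes f :: "'i \<Rightarrow> 'a \<Rightarrow> real"
  assumes "finite I" and "\<And>i. i \<in> I \<Longrightarrow> set_integrable M S (f i)"
  shows "(LINT x:S|M. (\<Sum>i\<in>I. f i x)) = (\<Sum>i\<in>I. LINT x:S|M. f i x)"
    and "set_integrable M S (\<lambda>x. \<Sum>i\<in>I. f i x)"
proof -
  have int: "\<And>i. i \<in> I \<Longrightarrow> integrable M (\<lambda>x. indicator S x *\<^sub>R f i x)"
    using assms(2) by (simp only: set_integrable_def)
  show "(LINT x:S|M. (\<Sum>i\<in>I. f i x)) = (\<Sum>i\<in>I. LINT x:S|M. f i x)"
    unfolding set_lebesgue_integral_def scaleR_sum_right
    using int by (rule Bochner_Integration.integral_sum)
  show "set_integrable M S (\<lambda>x. \<Sum>i\<in>I. f i x)"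
    unfolding set_integrable_def scaleR_sum_right
    using int by (rule Bochner_Integration.integrable_sum)
qed


section \<open>Cells and quarter cells\<close>

lemma gx_shift: "gx G (a - 1/2) = gx G a - hx G / 2" "gx G (a + 1/2) = gx G a + hx G / 2"
  and gy_shift: "gy G (b - 1/2) = gy G b - hy G / 2" "gy G (b + 1/2) = gy G b + hy G / 2"
  by (simp_all add: gx_def gy_def algebra_simps)

lemma cell_eq: "cell G a b = {gx G a - hx G / 2<..<gx G a + hx G / 2} \<times> {gy G b - hy G / 2<..<gy G b + hy G / 2}"
  by (simp add: cell_def gx_shift gy_shift)

lemma quarter_eq:
  "quarter G a b m =
     (if even m then {gx G a - hx G / 2<..<gx G a} else {gx G a<..<gx G a + hx G / 2}) \<times>
     (if m < 2 then {gy G b - hy G / 2<..<gy G b} else {gy G b<..<gy G b + hy G / 2})"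
  by (simp add: gx_shift gy_shift)

declare quarter.simps [simp del]

lemma bounded_cell [simp]: "bounded (cell G a b)"
  by (auto simp: cell_def intro!: bounded_Times)

lemma open_cell: "open (cell G a b)"
  by (auto simp: cell_def intro!: open_Times)

lemma open_quarter: "open (quarter G a b m)"
  by (auto simp: quarter_eq intro!: open_Times)

lemma sets_cell [measurable]: "cell G a b \<in> sets borel" "quarter G a b m \<in> sets borel"
  using open_cell open_quarter by auto

lemma quarter_subset_cell:
  assumes "hx G > 0" and "hy G > 0"
  shows "quarter G a b m \<subseteq> cell G a b"
  using assms by (auto simp: cell_eq quarter_eq split: if_splits)

text \<open>
  The quarters miss only the two centre lines of the cell, which are null sets.
\<close>

lemma set_integral_quarters:
  fixes f :: "real \<times> real \<Rightarrow> real"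
  assumes "hx G > 0" and "hy G > 0" and f: "set_integrable lborel (cell G a b) f"
  shows "(LINT z:cell G a b|lborel. f z) = (\<Sum>m<4. LINT z:quarter G a b m|lborel. f z)"
proof -
  have sum_lessThan_4: "(\<Sum>m<4. g m) = g 0 + g 1 + g 2 + g 3" for g :: "nat \<Rightarrow> real"
    by (simp add: eval_nat_numeral)
  have q: "set_integrable lborel (quarter G a b m) f" for m
    by (rule set_integrable_subset[OF f]) (use assms quarter_subset_cell in auto)
  have "(LINT z:cell G a b|lborel. f z) = (LINT z|lborel. (\<Sum>m<4. indicator (quarter G a b m) z *\<^sub>R f z))"
    unfolding set_lebesgue_integral_def
  proof (rule integral_cong_AE)
    have x: "AE z in lborel. z \<bullet> (1 :: real, 0 :: real) \<noteq> gx G a"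
      by (rule AE_lborel_inner_neq) (simp add: Basis_prod_def)
    have y: "AE z in lborel. z \<bullet> (0 :: real, 1 :: real) \<noteq> gy G b"
      by (rule AE_lborel_inner_neq) (simp add: Basis_prod_def)
    show "AE z in lborel. indicator (cell G a b) z *\<^sub>R f z = (\<Sum>m<4. indicator (quarter G a b m) z *\<^sub>R f z)"
      using x y
    proof eventually_elim
      case (elim z)
      then show ?case
        using assms(1,2)
        unfolding sum_lessThan_4 by (cases z) (auto simp: cell_eq quarter_eq indicator_def)
    qed
    show "(\<lambda>z. indicator (cell G a b) z *\<^sub>R f z) \<in> borel_measurable lborel"
      using f by (auto simp: set_integrable_def)
    show "(\<lambda>z. \<Sum>m<4. indicator (quarter G a b m) z *\<^sub>R f z) \<in> borel_measurable lborel"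
      using q by (intro borel_measurable_sum) (auto simp: set_integrable_def)
  qed
  also have "\<dots> = (\<Sum>m<4. LINT z:quarter G a b m|lborel. f z)"
    unfolding set_lebesgue_integral_def
    using q by (intro Bochner_Integration.integral_sum) (auto simp: set_integrable_def)
  finally show ?thesis .
qed

lemma set_integral_pos:
  fixes f :: "'a::euclidean_space \<Rightarrow> real"
  assumes "set_integrable lborel S f" and "open S" and "S \<noteq> {}" and "\<And>z. z \<in> S \<Longrightarrow> f z > 0"
  shows "(LINT z:S|lborel. f z) > 0"
proof -
  let ?f = "\<lambda>z. indicator S z *\<^sub>R f z"
  have nonneg: "?f z \<ge> 0" for z
    using assms(4)[of z] by (auto simp: indicator_def)
  have int: "integrable lborel ?f"
    using assms(1) by (simp add: set_integrable_def)
  have "integral\<^sup>L lborel ?f \<noteq> 0"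
  proof
    assume "integral\<^sup>L lborel ?f = 0"
    then have "AE z in lborel. ?f z = 0"
      using integral_nonneg_eq_0_iff_AE[OF int] nonneg by simp
    then have "AE z in lborel. z \<notin> S"
      by (rule AE_mp) (use assms(4) in \<open>force simp: indicator_def intro!: AE_I2\<close>)
    then have "emeasure lborel S = 0"
      using assms(2) by (subst (asm) AE_iff_measurable[OF _ refl]) auto
    then have "S \<in> null_sets lborel"
      using assms(2) by (auto simp: null_sets_def)
    then have "negligible S"
      by (simp add: negligible_iff_null_sets null_sets_completionI)
    then show False
      using assms(2,3) open_not_negligible by blast
  qed
  moreover have "integral\<^sup>L lborel ?f \<ge> 0"
    using nonneg by simp
  ultimately show ?thesis
    by (simp add: set_lebesgue_integral_def)
qed


section \<open>The Legendre basis of a cell\<close>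

lemma basis_fun_eq:
  "basis_fun G a b (i, j) = (\<lambda>z. poly (scaled_legendre (gx G a) (hx G) i) (fst z)
                                 * poly (scaled_legendre (gy G b) (hy G) j) (snd z))"
  by (auto simp: basis_fun_def poly_scaled_legendre)

lemma continuous_basis_fun [continuous_intros]: "continuous_on S (basis_fun G a b l)"
  by (cases l) (auto simp: basis_fun_eq intro!: continuous_intros)

lemma integrable_basis_fun_mult:
  "set_integrable lborel (cell G a b) f \<Longrightarrow> set_integrable lborel (cell G a b) (\<lambda>z. f z * basis_fun G a b l z)"
  by (rule set_integrable_mult_bounded) (auto intro: continuous_intros)

lemma integrable_basis_fun: "set_integrable lborel (cell G a b) (basis_fun G a b l)"
  by (cases l) (auto simp: basis_fun_eq cell_eq intro!: set_integral_tensor(1) set_integrable_poly)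

lemma basis_fun_orthogonal:
  assumes "hx G > 0" and "hy G > 0"
  shows "(LINT z:cell G a b|lborel. basis_fun G a b l z * basis_fun G a b l' z) = 0 \<longleftrightarrow> l \<noteq> l'"
proof -
  obtain i j i' j' where l: "l = (i, j)" "l' = (i', j')"
    by (cases l, cases l')
  let ?p = "scaled_legendre (gx G a) (hx G)" and ?q = "scaled_legendre (gy G b) (hy G)"
  have "(LINT z:cell G a b|lborel. basis_fun G a b l z * basis_fun G a b l' z) =
    (LINT z:cell G a b|lborel. poly (?p i * ?p i') (fst z) * poly (?q j * ?q j') (snd z))"
    by (simp add: l basis_fun_eq mult_ac)
  also have "\<dots> = (LINT x:{gx G a - hx G / 2<..<gx G a + hx G / 2}|lborel. poly (?p i * ?p i') x) *
                  (LINT y:{gy G b - hy G / 2<..<gy G b + hy G / 2}|lborel. poly (?q j * ?q j') y)"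
    unfolding cell_eq by (intro set_integral_tensor set_integrable_poly)
  also have "\<dots> = 0 \<longleftrightarrow> i \<noteq> i' \<or> j \<noteq> j'"
    using scaled_legendre_orthogonal[OF assms(1)] scaled_legendre_orthogonal[OF assms(2)]
    by (simp add: poly_mult_eta)
  finally show ?thesis by (auto simp: l)
qed

text \<open>
  The signs are those of \<open>\<xi>\<close>, \<open>\<eta>\<close> and \<open>\<xi>\<eta>\<close> on the quarter. The three sign patterns are linearly
  independent on the quarters \<open>0\<close>, \<open>1\<close>, \<open>2\<close>, which is why three quarter integrals determine the
  projection.
\<close>

lemma quarter_moments:
  assumes "hx G > 0" and "hy G > 0"
  shows "(LINT z:quarter G a b m|lborel. basis_fun G a b (0, 0) z) = hx G * hy G / 4" 
    and "(LINT z:quarter G a b m|lborel. basis_fun G a b (1, 0) z) = (if even m then -1 else 1) * (hx G * hy G / 8)" 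
    and "(LINT z:quarter G a b m|lborel. basis_fun G a b (0, 1) z) = (if m < 2 then -1 else 1) * (hx G * hy G / 8)"
    and "(LINT z:quarter G a b m|lborel. basis_fun G a b (1, 1) z)
           = (if even m then -1 else 1) * (if m < 2 then -1 else 1) * (hx G * hy G / 16)"
  unfolding basis_fun_eq quarter_eq One_nat_def
  by (cases "even m"; cases "m < 2";
      simp add: set_integral_tensor(2)[OF set_integrable_poly set_integrable_poly] half_moments assms)+

lemma poly_triangular_expansion:
  fixes Q :: "nat \<Rightarrow> real poly"
  assumes "\<And>i. degree (Q i) = i" and "\<And>i. Q i \<noteq> 0" and "degree p \<le> n"
  shows "\<exists>c. p = (\<Sum>i\<le>n. smult (c i) (Q i))"
  using assms(3)
proof (induction n arbitrary: p)
  case 0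
  obtain u v where uv: "p = [:u:]" "Q 0 = [:v:]"
    using 0 assms(1)[of 0] by (metis degree_0_id le_zero_eq)
  then have "v \<noteq> 0" using assms(2)[of 0] by auto
  then show ?case
    using uv by (intro exI[of _ "\<lambda>_. u / v"]) simp
next
  case (Suc n)
  define r where "r = coeff p (Suc n) / coeff (Q (Suc n)) (Suc n)"
  have lc: "coeff (Q (Suc n)) (Suc n) \<noteq> 0"
    using assms(1)[of "Suc n"] assms(2)[of "Suc n"] leading_coeff_0_iff by metis
  have "degree (p - smult r (Q (Suc n))) \<le> n"
  proof (rule degree_le, intro allI impI)
    fix i assume "n < i"
    then show "coeff (p - smult r (Q (Suc n))) i = 0"
      using Suc.prems assms(1)[of "Suc n"] lc
      by (cases "i = Suc n") (auto simp: r_def coeff_eq_0)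
  qed
  then obtain c where "p - smult r (Q (Suc n)) = (\<Sum>i\<le>n. smult (c i) (Q i))"
    using Suc.IH by blast
  then show ?case
    by (intro exI[of _ "c(Suc n := r)"]) (simp add: algebra_simps)
qed

definition total_degree_pairs :: "nat \<Rightarrow> (nat \<times> nat) set" where
  "total_degree_pairs k = {(i, j). i + j \<le> k}"

lemma total_degree_pairs_Sigma: "total_degree_pairs k = (SIGMA i:{..k}. {..k - i})"
  by (auto simp: total_degree_pairs_def)

lemma finite_total_degree_pairs [simp]: "finite (total_degree_pairs k)"
  by (simp add: total_degree_pairs_Sigma)

text \<open>
  A product of polynomials of degrees \<open>i\<close> and \<open>j\<close> expands into products of degrees \<open>l \<le> i\<close> and
  \<open>m \<le> j\<close>, so the bound on the total degree survives. Both directions between monomials and Legendre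
  products are instances.
\<close>

lemma tensor_change_of_basis:
  fixes P P' Q Q' :: "nat \<Rightarrow> real poly"
  assumes "\<And>i. degree (P i) \<le> i" "\<And>i. degree (P' i) \<le> i"
    and "\<And>i. degree (Q i) = i" "\<And>i. Q i \<noteq> 0" "\<And>i. degree (Q' i) = i" "\<And>i. Q' i \<noteq> 0"
  shows "\<exists>d. \<forall>x y. (\<Sum>(i, j)\<in>total_degree_pairs k. c (i, j) * (poly (P i) x * poly (P' j) y))
                  = (\<Sum>(i, j)\<in>total_degree_pairs k. d (i, j) * (poly (Q i) x * poly (Q' j) y))"
proof -
  let ?J = "total_degree_pairs k"
  have "\<exists>A. P i = (\<Sum>l\<le>i. smult (A l) (Q l))" for i
    using poly_triangular_expansion assms by blast
  then obtain A where A: "\<And>i. P i = (\<Sum>l\<le>i. smult (A i l) (Q l))"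
    by metis
  have "\<exists>A. P' i = (\<Sum>l\<le>i. smult (A l) (Q' l))" for i
    using poly_triangular_expansion assms by blast
  then obtain B where B: "\<And>i. P' i = (\<Sum>l\<le>i. smult (B i l) (Q' l))"
    by metis
  have mono: "poly (P i) x * poly (P' j) y
      = (\<Sum>(l, m)\<in>?J. (if l \<le> i \<and> m \<le> j then A i l * B j m else 0) * (poly (Q l) x * poly (Q' m) y))"
    if "(i, j) \<in> ?J" for i j x y
  proof -
    have "poly (P i) x * poly (P' j) y
       = (\<Sum>l\<le>i. \<Sum>m\<le>j. (A i l * poly (Q l) x) * (B j m * poly (Q' m) y))"
      by (simp add: A[of i] B[of j] poly_sum sum_product)
    also have "\<dots> = (\<Sum>(l, m)\<in>{..i} \<times> {..j}. (A i l * B j m) * (poly (Q l) x * poly (Q' m) y))"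
      by (simp add: sum.cartesian_product mult_ac)
    also have "\<dots> = (\<Sum>(l, m)\<in>?J. (if l \<le> i \<and> m \<le> j then A i l * B j m else 0) * (poly (Q l) x * poly (Q' m) y))"
      using that by (intro sum.mono_neutral_cong_left finite_total_degree_pairs)
        (auto simp: total_degree_pairs_def split: if_splits)
    finally show ?thesis .
  qed
  define d where "d = (\<lambda>(l, m). \<Sum>(i, j)\<in>?J. c (i, j) * (if l \<le> i \<and> m \<le> j then A i l * B j m else 0))"
  have "(\<Sum>(i, j)\<in>?J. c (i, j) * (poly (P i) x * poly (P' j) y))
      = (\<Sum>(l, m)\<in>?J. d (l, m) * (poly (Q l) x * poly (Q' m) y))" for x y
  proof -
    have "(\<Sum>(i, j)\<in>?J. c (i, j) * (poly (P i) x * poly (P' j) y))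
      = (\<Sum>(i, j)\<in>?J. \<Sum>(l, m)\<in>?J. c (i, j) * (if l \<le> i \<and> m \<le> j then A i l * B j m else 0) * (poly (Q l) x * poly (Q' m) y))"
      by (intro sum.cong refl) (auto simp: mono sum_distrib_left mult.assoc intro!: sum.cong)
    also have "\<dots> = (\<Sum>(l, m)\<in>?J. d (l, m) * (poly (Q l) x * poly (Q' m) y))"
      unfolding d_def split_def sum_distrib_right by (subst sum.swap) (simp cong: if_cong)
    finally show ?thesis .
  qed
  then show ?thesis by blast
qed

lemma polys_basis_expansion:
  assumes "hx G \<noteq> 0" and "hy G \<noteq> 0"
  shows "q \<in> polys k \<longleftrightarrow> (\<exists>c. \<forall>z. q z = (\<Sum>l\<in>total_degree_pairs k. c l * basis_fun G a b l z))"
proof -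
  let ?P = "\<lambda>i. monom (1::real) i"
  let ?Q = "scaled_legendre (gx G a) (hx G)" and ?Q' = "scaled_legendre (gy G b) (hy G)"
  have deg: "degree (?P i) = i" "?P i \<noteq> 0" "degree (?Q i) = i" "?Q i \<noteq> 0" "degree (?Q' i) = i" "?Q' i \<noteq> 0" for i
  proof -
    show "degree (?Q i) = i" "degree (?Q' i) = i"
      using assms by (simp_all add: degree_scaled_legendre)
    show "?Q i \<noteq> 0" "?Q' i \<noteq> 0"
      using assms by (auto simp: scaled_legendre_def pcompose_eq_0_iff)
  qed (simp_all add: degree_monom_eq)
  have monomials: "(\<Sum>i\<le>k. \<Sum>j\<le>k - i. c i j * x ^ i * y ^ j)
      = (\<Sum>(i, j)\<in>total_degree_pairs k. c i j * (poly (?P i) x * poly (?P j) y))" for c x y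
    by (simp add: total_degree_pairs_Sigma sum.Sigma poly_monom mult.assoc)
  have basis: "(\<Sum>l\<in>total_degree_pairs k. c l * basis_fun G a b l (x, y))
      = (\<Sum>(i, j)\<in>total_degree_pairs k. c (i, j) * (poly (?Q i) x * poly (?Q' j) y))" for c x y
    by (auto simp: basis_fun_eq intro!: sum.cong)
  show ?thesis
  proof
    assume "q \<in> polys k"
    then obtain c where "\<And>x y. q (x, y) = (\<Sum>i\<le>k. \<Sum>j\<le>k - i. c i j * x ^ i * y ^ j)"
      by (auto simp: polys_def)
    then show "\<exists>c. \<forall>z. q z = (\<Sum>l\<in>total_degree_pairs k. c l * basis_fun G a b l z)"
      using tensor_change_of_basis[of ?P ?P ?Q ?Q' "\<lambda>(i, j). c i j" k] deg
      by (auto simp: monomials basis)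
  next
    assume "\<exists>c. \<forall>z. q z = (\<Sum>l\<in>total_degree_pairs k. c l * basis_fun G a b l z)"
    then obtain c where c: "\<And>x y. q (x, y) = (\<Sum>(i, j)\<in>total_degree_pairs k. c (i, j) * (poly (?Q i) x * poly (?Q' j) y))"
      by (auto simp: basis)
    obtain d where "\<And>x y. q (x, y) = (\<Sum>(i, j)\<in>total_degree_pairs k. d (i, j) * (poly (?P i) x * poly (?P j) y))"
      using tensor_change_of_basis[of ?Q ?Q' ?P ?P c k] deg c by auto
    then show "q \<in> polys k"
      unfolding polys_def mem_Collect_eq by (intro exI[of _ "\<lambda>i j. d (i, j)"]) (simp add: monomials)
  qed
qed


section \<open>The projection on a cell\<close>

lemma integral_mult_basis_sum:
  assumes "finite I" and "set_integrable lborel (cell G a b) f"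
  shows "(LINT z:cell G a b|lborel. f z * (\<Sum>l\<in>I. c l * basis_fun G a b l z))
         = (\<Sum>l\<in>I. c l * (LINT z:cell G a b|lborel. f z * basis_fun G a b l z))"
proof -
  have "(LINT z:cell G a b|lborel. f z * (\<Sum>l\<in>I. c l * basis_fun G a b l z))
      = (LINT z:cell G a b|lborel. (\<Sum>l\<in>I. c l * (f z * basis_fun G a b l z)))"
    by (simp add: sum_distrib_left mult_ac)
  also have "\<dots> = (\<Sum>l\<in>I. LINT z:cell G a b|lborel. c l * (f z * basis_fun G a b l z))"
    using assms by (intro set_integral_finite_sum(1)) (auto intro: integrable_basis_fun_mult)
  finally show ?thesis by simp
qed

lemma integrable_basis_sum:
  assumes "finite I"
  shows "set_integrable lborel (cell G a b) (\<lambda>z. \<Sum>l\<in>I. c l * basis_fun G a b l z)"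
  using assms by (intro set_integral_finite_sum(2)) (auto intro: integrable_basis_fun)

lemma basis_coefficient:
  assumes "hx G > 0" and "hy G > 0" and "finite I" and "m \<in> I"
  shows "(LINT z:cell G a b|lborel. (\<Sum>l\<in>I. c l * basis_fun G a b l z) * basis_fun G a b m z)
         = c m * (LINT z:cell G a b|lborel. basis_fun G a b m z * basis_fun G a b m z)"
proof -
  have "(LINT z:cell G a b|lborel. basis_fun G a b m z * (\<Sum>l\<in>I. c l * basis_fun G a b l z))
      = (\<Sum>l\<in>I. c l * (LINT z:cell G a b|lborel. basis_fun G a b m z * basis_fun G a b l z))"
    by (intro integral_mult_basis_sum integrable_basis_fun assms)
  also have "\<dots> = (\<Sum>l\<in>I. if l = m then c m * (LINT z:cell G a b|lborel. basis_fun G a b m z * basis_fun G a b m z) else 0)"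
    using basis_fun_orthogonal[OF assms(1,2)] by (intro sum.cong) auto
  finally show ?thesis
    using assms by (simp add: mult.commute)
qed

definition test_pairs :: "nat \<Rightarrow> (nat \<times> nat) set" where
  "test_pairs k = total_degree_pairs k - {(1, 0), (0, 1), (1, 1)}"

lemma finite_test_pairs [simp]: "finite (test_pairs k)"
  by (simp add: test_pairs_def)

lemma test_space_eq:
  "test_space G a b = {v. \<exists>c. \<forall>z. v z = (\<Sum>l\<in>test_pairs (deg G). c l * basis_fun G a b l z)}"
  by (simp add: test_space_def test_pairs_def total_degree_pairs_def)

lemma sum_total_degree_pairs:
  fixes f :: "nat \<times> nat \<Rightarrow> real"
  assumes "k \<ge> 2"
  shows "sum f (total_degree_pairs k) = sum f (test_pairs k) + (f (1, 0) + f (0, 1) + f (1, 1))"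
proof -
  have "total_degree_pairs k = test_pairs k \<union> {(1, 0), (0, 1), (1, 1)}"
    using assms by (auto simp: total_degree_pairs_def test_pairs_def)
  moreover have "sum f \<dots> = sum f (test_pairs k) + sum f {(1, 0), (0, 1), (1, 1)}"
    by (intro sum.union_disjoint) (auto simp: test_pairs_def)
  ultimately show ?thesis by simp
qed

text \<open>
  The test space controls the coefficients in the first integral; the last term isolates the three
  that it leaves free.
\<close>

lemma quarter_integral_basis_sum:
  assumes "hx G > 0" and "hy G > 0" and "k \<ge> 2"
  shows "(LINT z:quarter G a b m|lborel. (\<Sum>l\<in>total_degree_pairs k. c l * basis_fun G a b l z))
    = (LINT z:quarter G a b m|lborel. (\<Sum>l\<in>test_pairs k. c l * basis_fun G a b l z))
      + (hx G * hy G / 8) * ((if even m then -1 else 1) * c (1, 0) + (if m < 2 then -1 else 1) * c (0, 1)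
           + (if even m then -1 else 1) * (if m < 2 then -1 else 1) * c (1, 1) / 2)"
proof -
  have sub: "set_integrable lborel (quarter G a b m) f" if "set_integrable lborel (cell G a b) f" 
    for f :: "real \<times> real \<Rightarrow> real"
    by (rule set_integrable_subset[OF that]) (use assms quarter_subset_cell in auto)
  have int: "set_integrable lborel (quarter G a b m) (\<lambda>z. c l * basis_fun G a b l z)" for l
    by (intro sub set_integrable_mult_right integrable_basis_fun)
  have int': "set_integrable lborel (quarter G a b m) (\<lambda>z. \<Sum>l\<in>test_pairs k. c l * basis_fun G a b l z)"
    by (intro sub integrable_basis_sum) simp
  have "(LINT z:quarter G a b m|lborel. (\<Sum>l\<in>total_degree_pairs k. c l * basis_fun G a b l z))
    = (LINT z:quarter G a b m|lborel. (\<Sum>l\<in>test_pairs k. c l * basis_fun G a b l z))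
      + (c (1, 0) * (LINT z:quarter G a b m|lborel. basis_fun G a b (1, 0) z)
         + c (0, 1) * (LINT z:quarter G a b m|lborel. basis_fun G a b (0, 1) z)
         + c (1, 1) * (LINT z:quarter G a b m|lborel. basis_fun G a b (1, 1) z))"
    unfolding sum_total_degree_pairs[OF assms(3)]
    by (simp only: set_integral_add int int' set_integral_mult_right)
  then show ?thesis
    unfolding quarter_moments[OF assms(1,2)] by (simp add: field_simps)
qed

definition is_proj_cell ::
    "cdg \<Rightarrow> (real \<times> real \<Rightarrow> real) \<Rightarrow> real \<Rightarrow> real \<Rightarrow> (real \<times> real \<Rightarrow> real) \<Rightarrow> bool" where
  "is_proj_cell G f a b q \<longleftrightarrow> q \<in> polys (deg G) \<and>
     (\<forall>m\<in>{0, 1, 2}. (LINT z:quarter G a b m|lborel. q z) = (LINT z:quarter G a b m|lborel. f z)) \<and>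
     (\<forall>v\<in>test_space G a b.
        (LINT z:cell G a b|lborel. q z * v z) = (LINT z:cell G a b|lborel. f z * v z))"

lemma proj_cell_eq_The: "proj_cell G f a b = (THE q. is_proj_cell G f a b q)"
  by (simp add: proj_cell_def is_proj_cell_def)

lemma test_space_condition:
  assumes "set_integrable lborel (cell G a b) f" and "set_integrable lborel (cell G a b) q"
  shows "(\<forall>v\<in>test_space G a b. (LINT z:cell G a b|lborel. q z * v z) = (LINT z:cell G a b|lborel. f z * v z))
    \<longleftrightarrow> (\<forall>l\<in>test_pairs (deg G). (LINT z:cell G a b|lborel. q z * basis_fun G a b l z)
                                = (LINT z:cell G a b|lborel. f z * basis_fun G a b l z))"
    (is "?L = ?R")
proof
  assume L: ?L
  show ?R
  proof
    fix l assume "l \<in> test_pairs (deg G)"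
    then have "basis_fun G a b l \<in> test_space G a b"
      unfolding test_space_eq
      by (intro CollectI exI[of _ "\<lambda>l'. if l' = l then 1 else 0"]) (simp add: if_distrib[of "\<lambda>x. x * _"] cong: if_cong)
    with L show "(LINT z:cell G a b|lborel. q z * basis_fun G a b l z)
               = (LINT z:cell G a b|lborel. f z * basis_fun G a b l z)"
      by blast
  qed
next
  assume R: ?R
  show ?L
  proof
    fix v assume "v \<in> test_space G a b"
    then obtain c where v: "\<And>z. v z = (\<Sum>l\<in>test_pairs (deg G). c l * basis_fun G a b l z)"
      by (auto simp: test_space_eq)
    show "(LINT z:cell G a b|lborel. q z * v z) = (LINT z:cell G a b|lborel. f z * v z)"
      unfolding v using R assms by (simp add: integral_mult_basis_sum)
  qed
qed

text \<open>
  In coefficients the conditions are triangular: orthogonality decouples those from the test space,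
  and the quarter integrals form a \<open>3 \<times> 3\<close> system for the others. Existence and uniqueness can then be
  read off.
\<close>

lemma is_proj_cell_iff_coefficients:
  assumes "hx G > 0" and "hy G > 0" and k: "deg G \<ge> 2" and f: "set_integrable lborel (cell G a b) f"
  shows "is_proj_cell G f a b q \<longleftrightarrow>
    (\<exists>c. (\<forall>z. q z = (\<Sum>l\<in>total_degree_pairs (deg G). c l * basis_fun G a b l z)) \<and>
      (\<forall>l\<in>test_pairs (deg G). c l * (LINT z:cell G a b|lborel. basis_fun G a b l z * basis_fun G a b l z)
                             = (LINT z:cell G a b|lborel. f z * basis_fun G a b l z)) \<and>
      (\<forall>m\<in>{0, 1, 2}. (LINT z:quarter G a b m|lborel. (\<Sum>l\<in>test_pairs (deg G). c l * basis_fun G a b l z))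
         + (hx G * hy G / 8) * ((if even m then -1 else 1) * c (1, 0) + (if m < 2 then -1 else 1) * c (0, 1)
           + (if even m then -1 else 1) * (if m < 2 then -1 else 1) * c (1, 1) / 2)
         = (LINT z:quarter G a b m|lborel. f z)))"
    (is "_ = (\<exists>c. ?E c \<and> ?T c \<and> ?Q c)")
proof -
  have "q \<in> polys (deg G) \<longleftrightarrow> (\<exists>c. ?E c)"
    by (rule polys_basis_expansion) (use assms in auto)
  moreover have "((\<forall>m\<in>{0, 1, 2}. (LINT z:quarter G a b m|lborel. q z) = (LINT z:quarter G a b m|lborel. f z)) \<and>
     (\<forall>v\<in>test_space G a b.
        (LINT z:cell G a b|lborel. q z * v z) = (LINT z:cell G a b|lborel. f z * v z))) \<longleftrightarrow> ?T c \<and> ?Q c"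
    if c: "?E c" for c
  proof -
    have q: "q = (\<lambda>z. \<Sum>l\<in>total_degree_pairs (deg G). c l * basis_fun G a b l z)"
      using c by auto
    have coeff: "(LINT z:cell G a b|lborel. q z * basis_fun G a b l z)
        = c l * (LINT z:cell G a b|lborel. basis_fun G a b l z * basis_fun G a b l z)"
      if "l \<in> test_pairs (deg G)" for l
      unfolding q using that by (intro basis_coefficient assms) (auto simp: test_pairs_def)
    have int: "set_integrable lborel (cell G a b) q"
      unfolding q by (rule integrable_basis_sum) simp
    show ?thesis
      unfolding test_space_condition[OF f int]
      using quarter_integral_basis_sum[OF assms(1,2) k, of a b _ c] coeff
      by (auto simp: q)
  qed
  ultimately show ?thesis
    unfolding is_proj_cell_def by blast
qed

lemma ex1_is_proj_cell:
  assumes "hx G > 0" and "hy G > 0" and k: "deg G \<ge> 2" and f: "set_integrable lborel (cell G a b) f"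
  shows "\<exists>!q. is_proj_cell G f a b q"
proof -
  let ?S = "test_pairs (deg G)" and ?B = "basis_fun G a b" and ?A = "hx G * hy G / 8"
  let ?N = "\<lambda>l. LINT z:cell G a b|lborel. ?B l z * ?B l z"
  have N: "?N l \<noteq> 0" for l
    using basis_fun_orthogonal[OF assms(1,2)] by blast
  have A: "?A > 0"
    using assms by simp
  have excl: "(1, 0) \<notin> ?S" "(0, 1) \<notin> ?S" "(1, 1) \<notin> ?S"
    by (auto simp: test_pairs_def)
  show ?thesis
    unfolding is_proj_cell_iff_coefficients[OF assms]
  proof (rule ex_ex1I)
    define c0 where "c0 l = (LINT z:cell G a b|lborel. f z * ?B l z) / ?N l" for l
    \<comment> \<open>The defects of the quarter integrals that \<open>\<xi>\<close>, \<open>\<eta>\<close>, \<open>\<xi>\<eta>\<close> must make up; adding the equations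
      of the system in pairs isolates each unknown.\<close>
    define r where "r m = ((LINT z:quarter G a b m|lborel. f z)
        - (LINT z:quarter G a b m|lborel. (\<Sum>l\<in>?S. c0 l * ?B l z))) / ?A" for m
    define c where "c = c0((1, 0) := - (r 0 + r 2) / 2, (0, 1) := - (r 0 + r 1) / 2, (1, 1) := - (r 1 + r 2))"
    have c: "c l = c0 l" if "l \<in> ?S" for l
      using that excl by (auto simp: c_def)
    have sum: "(\<Sum>l\<in>?S. c l * ?B l z) = (\<Sum>l\<in>?S. c0 l * ?B l z)" for z
      by (intro sum.cong) (auto simp: c)
    have c': "c (1, 0) = - (r 0 + r 2) / 2" "c (0, 1) = - (r 0 + r 1) / 2" "c (1, 1) = - (r 1 + r 2)"
      by (simp_all add: c_def)
    have r: "?A * r m = (LINT z:quarter G a b m|lborel. f z)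
        - (LINT z:quarter G a b m|lborel. (\<Sum>l\<in>?S. c0 l * ?B l z))" for m
      using A unfolding r_def by (simp only: nonzero_mult_div_cancel_left times_divide_eq_right less_irrefl)
    have comb: "(if even m then -1 else 1) * c (1, 0) + (if m < 2 then -1 else 1) * c (0, 1)
           + (if even m then -1 else 1) * (if m < 2 then -1 else 1) * c (1, 1) / 2 = r m" if "m \<in> {0, 1, 2}" for m
      using that unfolding c' by (auto simp: field_simps)
    show "\<exists>q c. (\<forall>z. q z = (\<Sum>l\<in>total_degree_pairs (deg G). c l * ?B l z)) \<and>
      (\<forall>l\<in>?S. c l * ?N l = (LINT z:cell G a b|lborel. f z * ?B l z)) \<and>
      (\<forall>m\<in>{0, 1, 2}. (LINT z:quarter G a b m|lborel. (\<Sum>l\<in>?S. c l * ?B l z))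
         + ?A * ((if even m then -1 else 1) * c (1, 0) + (if m < 2 then -1 else 1) * c (0, 1)
           + (if even m then -1 else 1) * (if m < 2 then -1 else 1) * c (1, 1) / 2)
         = (LINT z:quarter G a b m|lborel. f z))"
    proof (intro exI conjI allI ballI)
      fix l assume "l \<in> ?S"
      then show "c l * ?N l = (LINT z:cell G a b|lborel. f z * ?B l z)"
        using N by (simp add: c c0_def)
    next
      fix m :: nat assume m: "m \<in> {0, 1, 2}"
      show "(LINT z:quarter G a b m|lborel. (\<Sum>l\<in>?S. c l * ?B l z))
         + ?A * ((if even m then -1 else 1) * c (1, 0) + (if m < 2 then -1 else 1) * c (0, 1)
           + (if even m then -1 else 1) * (if m < 2 then -1 else 1) * c (1, 1) / 2)
         = (LINT z:quarter G a b m|lborel. f z)"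
        unfolding comb[OF m] r sum by simp
    qed (rule refl)
  next
    fix q q'
    let ?P = "\<lambda>q c. (\<forall>z. q z = (\<Sum>l\<in>total_degree_pairs (deg G). c l * ?B l z)) \<and>
      (\<forall>l\<in>?S. c l * ?N l = (LINT z:cell G a b|lborel. f z * ?B l z)) \<and>
      (\<forall>m\<in>{0, 1, 2}. (LINT z:quarter G a b m|lborel. (\<Sum>l\<in>?S. c l * ?B l z))
         + ?A * ((if even m then -1 else 1) * c (1, 0) + (if m < 2 then -1 else 1) * c (0, 1)
           + (if even m then -1 else 1) * (if m < 2 then -1 else 1) * c (1, 1) / 2)
         = (LINT z:quarter G a b m|lborel. f z))"
    assume "\<exists>c. ?P q c" and "\<exists>c. ?P q' c"
    then obtain c c' where c: "?P q c" and c': "?P q' c'"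
      by blast
    have eq: "c l = c' l" if "l \<in> ?S" for l
    proof -
      have "c l * ?N l = c' l * ?N l"
        using c c' that by simp
      then show ?thesis using N by simp
    qed
    have sum: "(\<Sum>l\<in>?S. c l * ?B l z) = (\<Sum>l\<in>?S. c' l * ?B l z)" for z
      by (intro sum.cong) (auto simp: eq)
    define F where "F d m = (if even m then -1 else 1) * d (1, 0) + (if m < 2 then -1 else 1) * d (0, 1)
           + (if even m then -1 else 1) * (if m < 2 then -1 else 1) * d (1, 1) / 2"
      for d :: "nat \<times> nat \<Rightarrow> real" and m :: nat
    have F: "F c m = F c' m" if "m \<in> {0, 1, 2}" for m
    proof -
      have "(LINT z:quarter G a b m|lborel. (\<Sum>l\<in>?S. c l * ?B l z)) + ?A * F c m
          = (LINT z:quarter G a b m|lborel. (\<Sum>l\<in>?S. c' l * ?B l z)) + ?A * F c' m"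
        unfolding F_def
        using bspec[OF conjunct2[OF conjunct2[OF c]] that] bspec[OF conjunct2[OF conjunct2[OF c']] that]
        by (rule trans[OF _ sym])
      then show ?thesis
        using A unfolding sum by auto
    qed
    have special: "c (1, 0) = c' (1, 0)" "c (0, 1) = c' (0, 1)" "c (1, 1) = c' (1, 1)"
      using F[of 0] F[of 1] F[of 2] by (simp_all add: F_def)
    have "q z = (\<Sum>l\<in>total_degree_pairs (deg G). c l * ?B l z)"
      and "q' z = (\<Sum>l\<in>total_degree_pairs (deg G). c' l * ?B l z)" for z
      using c c' by blast+
    then show "q = q'"
      by (intro ext) (simp only: sum_total_degree_pairs[OF k] sum special)
  qed
qed

lemma proj_cell_eqI:
  assumes "hx G > 0" and "hy G > 0" and "deg G \<ge> 2" and "set_integrable lborel (cell G a b) f"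
    and "is_proj_cell G f a b q"
  shows "proj_cell G f a b = q"
  unfolding proj_cell_eq_The using ex1_is_proj_cell[OF assms(1-4)] assms(5)
  by (rule the1_equality[of "is_proj_cell G f a b" q])

lemma is_proj_cell_proj_cell:
  assumes "hx G > 0" and "hy G > 0" and "deg G \<ge> 2" and "set_integrable lborel (cell G a b) f"
  shows "is_proj_cell G f a b (proj_cell G f a b)"
  using ex1_is_proj_cell[OF assms] unfolding proj_cell_eq_The by (rule theI')

lemma polys_scale:
  assumes "q \<in> polys k"
  shows "(\<lambda>z. r * q z) \<in> polys k"
proof -
  obtain c where "\<And>x y. q (x, y) = (\<Sum>i\<le>k. \<Sum>j\<le>k - i. c i j * x ^ i * y ^ j)"
    using assms by (auto simp: polys_def)
  then show ?thesis
    unfolding polys_def by (intro CollectI exI[of _ "\<lambda>i j. r * c i j"]) (simp add: sum_distrib_left mult_ac)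
qed

lemma proj_cell_scale:
  assumes "hx G > 0" and "hy G > 0" and "deg G \<ge> 2" and "set_integrable lborel (cell G a b) f"
  shows "proj_cell G (\<lambda>z. r * f z) a b = (\<lambda>z. r * proj_cell G f a b z)"
proof (rule proj_cell_eqI)
  show "is_proj_cell G (\<lambda>z. r * f z) a b (\<lambda>z. r * proj_cell G f a b z)"
    using is_proj_cell_proj_cell[OF assms]
    by (auto simp: is_proj_cell_def polys_scale mult.assoc)
qed (use assms in auto)

lemma integrable_polys:
  assumes "hx G > 0" and "hy G > 0" and "q \<in> polys k"
  shows "set_integrable lborel (cell G a b) q"
proof -
  obtain c where "\<And>z. q z = (\<Sum>l\<in>total_degree_pairs k. c l * basis_fun G a b l z)"
    using polys_basis_expansion[of G q k a b] assms by auto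
  then have "q = (\<lambda>z. \<Sum>l\<in>total_degree_pairs k. c l * basis_fun G a b l z)"
    by (rule ext)
  then show ?thesis
    using integrable_basis_sum[of "total_degree_pairs k" G a b c] by simp
qed

text \<open>
  The last quarter comes for free: the constants belong to the test space, so the integral over the
  whole cell is preserved as well.
\<close>

lemma proj_cell_quarter_integral:
  assumes "hx G > 0" and "hy G > 0" and "deg G \<ge> 2" and f: "set_integrable lborel (cell G a b) f"
    and "m < 4"
  shows "(LINT z:quarter G a b m|lborel. proj_cell G f a b z) = (LINT z:quarter G a b m|lborel. f z)"
proof -
  let ?q = "proj_cell G f a b"
  have q: "is_proj_cell G f a b ?q"
    by (rule is_proj_cell_proj_cell) fact+
  have three: "(LINT z:quarter G a b m|lborel. ?q z) = (LINT z:quarter G a b m|lborel. f z)" if "m \<in> {0, 1, 2}" for m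
    using q that unfolding is_proj_cell_def by blast
  have one: "basis_fun G a b (0, 0) = (\<lambda>z. 1)"
    by (auto simp: basis_fun_def)
  have int: "set_integrable lborel (cell G a b) ?q"
    using q assms(1,2) by (intro integrable_polys) (auto simp: is_proj_cell_def)
  have "(0, 0) \<in> test_pairs (deg G)"
    by (simp add: test_pairs_def total_degree_pairs_def)
  then have "(LINT z:cell G a b|lborel. ?q z) = (LINT z:cell G a b|lborel. f z)"
    using q test_space_condition[OF f int] one unfolding is_proj_cell_def by fastforce
  then have "(\<Sum>m<4. LINT z:quarter G a b m|lborel. ?q z) = (\<Sum>m<4. LINT z:quarter G a b m|lborel. f z)"
    using set_integral_quarters[OF assms(1,2) int] set_integral_quarters[OF assms(1,2) f] by simp
  then have "(LINT z:quarter G a b 3|lborel. ?q z) = (LINT z:quarter G a b 3|lborel. f z)"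
    using three[of 0] three[of 1] three[of 2] by (simp add: eval_nat_numeral)
  moreover have "m \<in> {0, 1, 2} \<or> m = 3"
    using assms by auto
  ultimately show ?thesis
    using three by blast
qed


section \<open>Overlapping cells\<close>

lemma mem_cell: "z \<in> cell G a b \<longleftrightarrow> \<bar>fst z - gx G a\<bar> < hx G / 2 \<and> \<bar>snd z - gy G b\<bar> < hy G / 2"
  by (cases z) (auto simp: cell_eq abs_if)

definition closed_cell :: "cdg \<Rightarrow> real \<Rightarrow> real \<Rightarrow> (real \<times> real) set" where
  "closed_cell G a b = {z. \<bar>fst z - gx G a\<bar> \<le> hx G / 2 \<and> \<bar>snd z - gy G b\<bar> \<le> hy G / 2}"

lemma mesh_congruent:
  assumes "(a, b) \<in> mesh A" and "(a', b') \<in> mesh A"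
  shows "a' - a \<in> \<int>" and "b' - b \<in> \<int>"
proof -
  have "a' - a \<in> \<int> \<and> b' - b \<in> \<int>"
  proof (cases A)
    case D
    then show ?thesis
      using assms Ints_diff[of "a' - 1/2" "a - 1/2"] Ints_diff[of "b' - 1/2" "b - 1/2"] by simp
  qed (use assms in auto)
  then show "a' - a \<in> \<int>" and "b' - b \<in> \<int>" by auto
qed

lemma mesh_other_shift:
  assumes "(a, b) \<in> mesh A" and "s \<in> {-1/2, 1/2}" and "t \<in> {-1/2, 1/2}"
  shows "(a + s, b + t) \<in> mesh (other A)"
proof -
  have shift: "x + s - 1/2 \<in> \<int>" if "x \<in> \<int>" "s \<in> {-1/2, 1/2}" for x s :: real
  proof -
    have "s - 1/2 = -1 \<or> s - 1/2 = 0"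
      using that(2) by auto
    then have "s - 1/2 \<in> \<int>"
      by (metis Ints_0 Ints_1 Ints_minus)
    then show ?thesis
      using Ints_add[OF that(1), of "s - 1/2"] by (simp add: algebra_simps)
  qed
  have shift_half: "x + s \<in> \<int>" if "x - 1/2 \<in> \<int>" "s \<in> {-1/2, 1/2}" for x s :: real
    using Ints_add[OF shift[OF that] Ints_1] by simp
  show ?thesis
    using assms(1) shift[OF _ assms(2)] shift[OF _ assms(3)] shift_half[OF _ assms(2)] shift_half[OF _ assms(3)]
    by (cases A) auto
qed

lemma cell_unique:
  assumes "hx G > 0" and "hy G > 0" and "(a, b) \<in> mesh A" and "(a', b') \<in> mesh A"
    and "z \<in> cell G a b" and "z \<in> cell G a' b'"
  shows "a' = a \<and> b' = b"
proof -
  have eq0: "d = 0" if "d \<in> \<int>" "\<bar>d * h\<bar> < h" "h > 0" for d h :: real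
  proof -
    have "\<bar>d\<bar> * h < 1 * h"
      using that by (simp add: abs_mult)
    then have "\<bar>d\<bar> < 1"
      using that by (simp only: mult_less_cancel_right_pos)
    then show ?thesis
      using that(1) by (auto elim!: Ints_cases)
  qed
  have "(a' - a) * hx G = gx G a' - gx G a" "(b' - b) * hy G = gy G b' - gy G b"
    by (simp_all add: gx_def gy_def algebra_simps)
  then have "\<bar>(a' - a) * hx G\<bar> < hx G" "\<bar>(b' - b) * hy G\<bar> < hy G"
    using assms(5,6) unfolding mem_cell by linarith+
  then show ?thesis
    using eq0[of "a' - a" "hx G"] eq0[of "b' - b" "hy G"] mesh_congruent[OF assms(3,4)] assms(1,2) by simp
qed

lemma piecewise_in_cell:
  assumes "hx G > 0" and "hy G > 0" and "(a, b) \<in> mesh A" and "z \<in> cell G a b"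
  shows "piecewise G A q z = q a b z"
proof -
  have "(THE (a, b). (a, b) \<in> mesh A \<and> z \<in> cell G a b) = (a, b)"
  proof (rule the_equality)
    show "case (a, b) of (a, b) \<Rightarrow> (a, b) \<in> mesh A \<and> z \<in> cell G a b"
      using assms(3,4) by simp
    show "c = (a, b)" if "case c of (a, b) \<Rightarrow> (a, b) \<in> mesh A \<and> z \<in> cell G a b" for c
    proof (cases c)
      case (Pair a' b')
      then show ?thesis
        using cell_unique[OF assms(1-3) _ assms(4), of a' b'] that by simp
    qed
  qed
  moreover have "\<exists>(a, b)\<in>mesh A. z \<in> cell G a b"
    using assms(3,4) by blast
  ultimately show ?thesis
    by (simp add: piecewise_def)
qed

lemma piecewise_outside:
  assumes "\<And>a b. (a, b) \<in> mesh A \<Longrightarrow> z \<notin> cell G a b"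
  shows "piecewise G A q z = 0"
  using assms by (auto simp: piecewise_def)

text \<open>
  The offset of a cell of the other mesh is a half-integer, and it is less than \<open>1\<close> in absolute value
  if the open cell meets the closed cell.
\<close>

lemma other_cell_index:
  assumes "hx G > 0" and "hy G > 0" and "(a, b) \<in> mesh A" and "(a', b') \<in> mesh (other A)"
    and "z \<in> closed_cell G a b" and "z \<in> cell G a' b'"
  shows "a' - a \<in> {-1/2, 1/2} \<and> b' - b \<in> {-1/2, 1/2}"
proof -
  have half: "d - 1/2 \<in> {-1/2, 1/2}" if d: "d \<in> \<int>" and "\<bar>(d - 1/2) * h\<bar> < h" "h > 0" for d h :: real
  proof -
    have "\<bar>d - 1/2\<bar> * h < 1 * h"
      using that by (simp add: abs_mult)
    then have "\<bar>d - 1/2\<bar> < 1"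
      using that by (simp only: mult_less_cancel_right_pos)
    moreover obtain n where "d = of_int n"
      using d by (auto elim: Ints_cases)
    ultimately have "n > -1" "n < 2"
      by linarith+
    then have "n = 0 \<or> n = 1" by auto
    then show ?thesis
      using \<open>d = of_int n\<close> by auto
  qed
  have "(a + 1/2, b + 1/2) \<in> mesh (other A)"
    using assms(3) by (intro mesh_other_shift) auto
  then have "a' - (a + 1/2) \<in> \<int>" "b' - (b + 1/2) \<in> \<int>"
    using mesh_congruent assms(4) by blast+
  then have ints: "a' - a + 1/2 \<in> \<int>" "b' - b + 1/2 \<in> \<int>"
    using Ints_add[OF _ Ints_1, of "a' - (a + 1/2)"] Ints_add[OF _ Ints_1, of "b' - (b + 1/2)"]
    by (simp_all add: algebra_simps)
  have "(a' - a) * hx G = gx G a' - gx G a" "(b' - b) * hy G = gy G b' - gy G b"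
    by (simp_all add: gx_def gy_def algebra_simps)
  then have "\<bar>(a' - a) * hx G\<bar> < hx G" "\<bar>(b' - b) * hy G\<bar> < hy G"
    using assms(5,6) unfolding mem_cell closed_cell_def mem_Collect_eq by linarith+
  then show ?thesis
    using half[OF ints(1), of "hx G"] half[OF ints(2), of "hy G"] assms(1,2) by simp
qed

lemma stencil_cells_neighbour:
  assumes "(a, b) \<in> stencil_cells G \<Omega> A" and "s \<in> {-1/2, 1/2}" and "t \<in> {-1/2, 1/2}"
  shows "(a + s, b + t) \<in> mesh (other A)" and "cell G (a + s) (b + t) \<subseteq> \<Omega>"
proof -
  show "(a + s, b + t) \<in> mesh (other A)"
    using assms by (intro mesh_other_shift) (auto simp: stencil_cells_def)
  have "cell G (a + s) (b + t) \<subseteq> stencil G a b"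
    unfolding stencil_def using assms(2,3) by blast
  then show "cell G (a + s) (b + t) \<subseteq> \<Omega>"
    using assms(1) by (auto simp: stencil_cells_def)
qed

text \<open>
  Each quarter of a cell is the opposite quarter of the neighbour of the other mesh that covers it;
  opposite quarters have numbers that add up to \<open>3\<close>.
\<close>

lemma quarter_neighbour:
  assumes "m < 4"
  shows "quarter G a b m =
    quarter G (a + (if even m then -1/2 else 1/2)) (b + (if m < 2 then -1/2 else 1/2)) (3 - m)"
proof -
  have "even (3 - m) \<longleftrightarrow> odd m" "3 - m < 2 \<longleftrightarrow> \<not> m < 2"
    using assms by auto
  then show ?thesis
    by (auto simp: quarter_eq gx_def gy_def algebra_simps)
qed


section \<open>The projected hydrostatic state on the cells of the stencil\<close>

text \<open>
  The closed cell is covered by the four overlapping cells, where \<open>f\<close> is integrable and the projection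
  exists, and by their edges, where both sides are \<open>0\<close>.
\<close>

lemma proj_scale:
  assumes "hx G > 0" and "hy G > 0" and "deg G \<ge> 2"
    and st: "(a, b) \<in> stencil_cells G \<Omega> A" and f: "set_integrable lborel \<Omega> f" and z: "z \<in> closed_cell G a b"
  shows "proj G (other A) (\<lambda>w. r * f w) z = r * proj G (other A) f z"
proof (cases "\<exists>a' b'. (a', b') \<in> mesh (other A) \<and> z \<in> cell G a' b'")
  case True
  then obtain a' b' where ab': "(a', b') \<in> mesh (other A)" "z \<in> cell G a' b'"
    by blast
  have "a' - a \<in> {-1/2, 1/2} \<and> b' - b \<in> {-1/2, 1/2}"
    using other_cell_index[OF assms(1,2) _ ab'(1) z ab'(2)] st by (auto simp: stencil_cells_def)
  then have "cell G a' b' \<subseteq> \<Omega>"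
    using stencil_cells_neighbour(2)[OF st, of "a' - a" "b' - b"] by simp
  then have "set_integrable lborel (cell G a' b') f"
    using f by (intro set_integrable_subset[OF f]) auto
  then show ?thesis
    using proj_cell_scale[OF assms(1-3), of a' b' f r]
    by (simp add: proj_def piecewise_in_cell[OF assms(1,2) ab'])
next
  case False
  then show ?thesis
    by (simp add: proj_def piecewise_outside)
qed

lemma proj_zero:
  assumes "hx G > 0" and "hy G > 0" and "deg G \<ge> 2"
  shows "proj G A (\<lambda>w. 0) z = 0"
proof (cases "\<exists>a b. (a, b) \<in> mesh A \<and> z \<in> cell G a b")
  case True
  then obtain a b where ab: "(a, b) \<in> mesh A" "z \<in> cell G a b"
    by blast
  have "proj_cell G (\<lambda>w. 0) a b = (\<lambda>w. 0)"
    using proj_cell_scale[OF assms, of a b "\<lambda>w. 0" 0] by (simp add: set_integrable_def)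
  then show ?thesis
    by (simp add: proj_def piecewise_in_cell[OF assms(1,2) ab])
qed (simp add: proj_def piecewise_outside)

text \<open>
  On every quarter of the cell the projection is a polynomial with the same integral as \<open>f\<close>, by
  \<open>proj_cell_quarter_integral\<close> for the covering neighbour.
\<close>

lemma proj_other_mesh_integral_pos:
  assumes "hx G > 0" and "hy G > 0" and "deg G \<ge> 2"
    and st: "(a, b) \<in> stencil_cells G \<Omega> A" and f: "set_integrable lborel \<Omega> f" and pos: "\<And>z. z \<in> \<Omega> \<Longrightarrow> f z > 0"
  shows "set_integrable lborel (cell G a b) (proj G (other A) f)"
    and "(LINT z:cell G a b|lborel. proj G (other A) f z) > 0"
proof -
  define s t :: "nat \<Rightarrow> real" where
    "s m = (if even m then -1/2 else 1/2)" and "t m = (if m < 2 then -1/2 else 1/2)" for m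
  define q where "q m = proj_cell G f (a + s m) (b + t m)" for m
  let ?g = "proj G (other A) f"
  have st': "s m \<in> {-1/2, 1/2}" "t m \<in> {-1/2, 1/2}" for m
    by (auto simp: s_def t_def)
  note nb = stencil_cells_neighbour[OF st st']
  have quarter: "quarter G a b m = quarter G (a + s m) (b + t m) (3 - m)" if "m < 4" for m
    using quarter_neighbour[OF that] by (simp add: s_def t_def)
  have sub: "quarter G a b m \<subseteq> cell G (a + s m) (b + t m)" if "m < 4" for m
    unfolding quarter[OF that] using assms(1,2) by (rule quarter_subset_cell)
  have f': "set_integrable lborel (cell G (a + s m) (b + t m)) f" for m
    by (rule set_integrable_subset[OF f]) (use nb(2) in auto)
  have q_int: "set_integrable lborel (quarter G a b m) (q m)" if "m < 4" for m
  proof (rule set_integrable_subset[OF _ _ sub[OF that]])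
    show "set_integrable lborel (cell G (a + s m) (b + t m)) (q m)"
      unfolding q_def using is_proj_cell_proj_cell[OF assms(1-3) f', of m]
      by (intro integrable_polys assms) (auto simp: is_proj_cell_def)
  qed auto
  have q_pos: "(LINT z:quarter G a b m|lborel. q m z) > 0" if "m < 4" for m
  proof -
    have "(LINT z:quarter G a b m|lborel. q m z) = (LINT z:quarter G a b m|lborel. f z)"
      unfolding q_def quarter[OF that]
      by (rule proj_cell_quarter_integral) (use assms f' in auto)
    moreover have "(LINT z:quarter G a b m|lborel. f z) > 0"
    proof (rule set_integral_pos)
      have sub\<Omega>: "quarter G a b m \<subseteq> \<Omega>"
        using sub[OF that] nb(2) by blast
      show "set_integrable lborel (quarter G a b m) f"
        by (rule set_integrable_subset[OF f _ sub\<Omega>]) simp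
      show "quarter G a b m \<noteq> {}"
        using assms(1,2) by (auto simp: quarter_eq)
      show "f z > 0" if "z \<in> quarter G a b m" for z
        using pos sub\<Omega> that by blast
    qed (rule open_quarter)
    ultimately show ?thesis by simp
  qed
  have g: "?g z = q m z" if "m < 4" "z \<in> quarter G a b m" for m z
    unfolding proj_def q_def
    by (rule piecewise_in_cell) (use assms nb(1) sub[OF that(1)] that(2) in auto)
  \<comment> \<open>The centre lines are edges of the other mesh. The projection vanishes there, so the decomposition
    into quarters below is exact and no null sets have to be discarded.\<close>
  have g0: "?g z = 0" if z: "z \<in> cell G a b" and centre: "fst z = gx G a \<or> snd z = gy G b" for z
    unfolding proj_def
  proof (rule piecewise_outside)
    fix a' b' assume ab': "(a', b') \<in> mesh (other A)"
    show "z \<notin> cell G a' b'"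
    proof
      assume z': "z \<in> cell G a' b'"
      have "z \<in> closed_cell G a b"
        using z by (auto simp: mem_cell closed_cell_def)
      then have "a' - a \<in> {-1/2, 1/2} \<and> b' - b \<in> {-1/2, 1/2}"
        using other_cell_index[OF assms(1,2) _ ab' _ z'] st by (auto simp: stencil_cells_def)
      moreover have "d * h \<in> {-h / 2, h / 2}" if "d \<in> {-1/2, 1/2}" for d h :: real
        using that by (elim insertE emptyE; hypsubst; simp)
      moreover have "gx G a' - gx G a = (a' - a) * hx G" "gy G b' - gy G b = (b' - b) * hy G"
        by (simp_all add: gx_def gy_def algebra_simps)
      ultimately have "gx G a' - gx G a \<in> {-hx G / 2, hx G / 2}" "gy G b' - gy G b \<in> {-hy G / 2, hy G / 2}"
        by metis+
      then show False
        using z' centre unfolding mem_cell insert_iff empty_iff by (smt (verit) field_sum_of_halves)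
    qed
  qed
  have decomp: "indicator (cell G a b) z *\<^sub>R ?g z = (\<Sum>m<4. indicator (quarter G a b m) z *\<^sub>R q m z)" for z
  proof -
    have "indicator (quarter G a b m) z *\<^sub>R q m z = indicator (quarter G a b m) z *\<^sub>R ?g z" if "m < 4" for m
      using g[OF that, of z] by (simp add: indicator_def)
    then have "(\<Sum>m<4. indicator (quarter G a b m) z *\<^sub>R q m z)
             = (\<Sum>m<4. indicator (quarter G a b m) z) *\<^sub>R ?g z"
      unfolding scaleR_sum_left by (intro sum.cong) auto
    also have "\<dots> = indicator (cell G a b) z *\<^sub>R ?g z"
    proof (cases "fst z = gx G a \<or> snd z = gy G b")
      case True
      then have "z \<notin> quarter G a b m" for m
        by (auto simp: quarter_eq split: if_splits)
      then show ?thesis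
        using g0[OF _ True] by (auto simp: indicator_def)
    next
      case False
      have "(\<Sum>m<4. indicator (quarter G a b m) z :: real)
          = indicator (quarter G a b 0) z + indicator (quarter G a b 1) z
            + indicator (quarter G a b 2) z + indicator (quarter G a b 3) z"
        by (simp add: eval_nat_numeral)
      also have "\<dots> = indicator (cell G a b) z"
        using False assms(1,2) by (cases z) (auto simp: cell_eq quarter_eq indicator_def)
      finally show ?thesis by simp
    qed
    finally show ?thesis by simp
  qed
  have int: "integrable lborel (\<lambda>z. indicator (quarter G a b m) z *\<^sub>R q m z)" if "m \<in> {..<4}" for m
    using q_int[of m] that unfolding set_integrable_def by simp
  show "set_integrable lborel (cell G a b) ?g"
    unfolding set_integrable_def decomp using int by (rule Bochner_Integration.integrable_sum)
  have "(LINT z:cell G a b|lborel. ?g z) = (\<Sum>m<4. LINT z:quarter G a b m|lborel. q m z)"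
    unfolding set_lebesgue_integral_def decomp using int by (rule Bochner_Integration.integral_sum)
  also have "\<dots> > 0"
    using q_pos by (intro sum_pos) (auto simp: lessThan_empty_iff)
  finally show "(LINT z:cell G a b|lborel. ?g z) > 0" .
qed

lemma L2_on_imp_integrable:
  assumes "L2_on \<Omega> f" and "\<Omega> = box lo up"
  shows "set_integrable lborel \<Omega> f"
proof -
  have meas: "(\<lambda>z. indicator \<Omega> z *\<^sub>R f z) \<in> borel_measurable lborel"
    and sq: "set_integrable lborel \<Omega> (\<lambda>z. (f z)\<^sup>2)"
    using assms(1) by (auto simp: L2_on_def set_borel_measurable_def)
  have one: "set_integrable lborel \<Omega> (\<lambda>z. 1 :: real)"
  proof -
    have "integrable lborel (indicator (box lo up) :: _ \<Rightarrow> real)"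
      by (rule integrable_real_indicator[OF _ emeasure_lborel_box_finite]) simp
    then show ?thesis
      using assms(2) by (simp add: set_integrable_def)
  qed
  have int: "set_integrable lborel \<Omega> (\<lambda>z. 1 + (f z)\<^sup>2)"
    by (rule set_integral_add(1)[OF one sq])
  show ?thesis
    unfolding set_integrable_def
  proof (rule Bochner_Integration.integrable_bound[OF int[unfolded set_integrable_def] meas], intro AE_I2)
    fix z
    have "\<bar>f z\<bar> \<le> 1 + (f z)\<^sup>2"
    proof -
      have "(\<bar>f z\<bar> - 1)\<^sup>2 \<ge> 0" by simp
      then have "2 * \<bar>f z\<bar> \<le> 1 + (f z)\<^sup>2" by (simp add: power2_diff)
      then show ?thesis by linarith
    qed
    then show "norm (indicator \<Omega> z *\<^sub>R f z) \<le> norm (indicator \<Omega> z *\<^sub>R (1 + (f z)\<^sup>2))"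
      by (simp add: indicator_def)
  qed
qed


section \<open>Balance of flux and source\<close>

abbreviation e2 :: "real^4" where "e2 \<equiv> vector [0, 1, 0, 0]"
abbreviation e3 :: "real^4" where "e3 \<equiv> vector [0, 0, 1, 0]"

lemma vector_4:
  "(vector [w, x, y, z] :: 'a::zero^4) $ 1 = w" "(vector [w, x, y, z] :: 'a^4) $ 2 = x"
  "(vector [w, x, y, z] :: 'a^4) $ 3 = y" "(vector [w, x, y, z] :: 'a^4) $ 4 = z"
  by (simp_all add: vector_def)

definition momentum_embedding :: "real^2^4" where
  "momentum_embedding = vector [vector [0, 0], vector [1, 0], vector [0, 1], vector [0, 0]]"

lemma momentum_embedding_mult: "momentum_embedding *v w = w $ 1 *\<^sub>R e2 + w $ 2 *\<^sub>R e3"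
  by (simp add: vec_eq_iff forall_4 matrix_vector_mult_def momentum_embedding_def sum_2 vector_4 vector_2)

text \<open>
  At rest the last row of \<open>Q\<close>, the momentum, vanishes.
\<close>

lemma Qmat_rest: "U $ 2 = 0 \<Longrightarrow> U $ 3 = 0 \<Longrightarrow> Qmat U = U $ 1 *\<^sub>R momentum_embedding"
  by (simp add: vec_eq_iff forall_4 forall_2 Qmat_def momentum_embedding_def vector_4 vector_2)

text \<open>
  The kinetic term of the pressure is \<open>0 / (2 \<rho>)\<close>, which is \<open>0\<close> also where the projected density
  happens to vanish.
\<close>

lemma flux_rest:
  assumes "U $ 2 = 0" and "U $ 3 = 0"
  shows "flux1 \<gamma> U = ((\<gamma> - 1) * U $ 4) *\<^sub>R e2" and "flux2 \<gamma> U = ((\<gamma> - 1) * U $ 4) *\<^sub>R e3"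
  using assms by (simp_all add: vec_eq_iff forall_4 flux1_def flux2_def pressure_def Let_def vector_4)

lemma Ush_components:
  assumes "hx G > 0" and "hy G > 0" and "deg G \<ge> 2"
  shows "Ush G A \<rho>s ps z $ 1 = proj G A \<rho>s z" 
    and "Ush G A \<rho>s ps z $ 2 = 0" and "Ush G A \<rho>s ps z $ 3 = 0"
    and "Ush G A \<rho>s ps z $ 4 = proj G A (\<lambda>w. ps w / (gam G - 1)) z"
  using proj_zero[OF assms] by (simp_all add: Ush_def Us_def vector_4)

lemma half_node_bounds:
  assumes "h > 0" and "\<alpha> \<in> {1..N}"
  shows "\<bar>half_node c h N \<kappa> \<alpha> - c\<bar> \<le> h / 2"
proof -
  have "\<bar>h / 4 * gauss_node N \<alpha>\<bar> \<le> h / 4 * 1"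
    using gauss_node_bounds[OF assms(2)] assms(1)
    unfolding abs_mult by (intro mult_mono) auto
  then show ?thesis
    unfolding half_node_def by (split if_split) linarith
qed

lemma quadrature_points:
  assumes "hx G > 0" and "hy G > 0" and "\<alpha> \<in> {1..ngauss G}" and "\<mu> \<in> {1..ngauss G}"
  shows "(xnode G a \<kappa> \<alpha>, ynode G b \<sigma> \<mu>) \<in> closed_cell G a b"
    and "(gx G (a + 1/2), ynode G b \<sigma> \<mu>) \<in> closed_cell G a b"
    and "(gx G (a - 1/2), ynode G b \<sigma> \<mu>) \<in> closed_cell G a b"
    and "(xnode G a \<kappa> \<alpha>, gy G (b + 1/2)) \<in> closed_cell G a b"
    and "(xnode G a \<kappa> \<alpha>, gy G (b - 1/2)) \<in> closed_cell G a b"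
  using assms half_node_bounds
  by (auto simp: closed_cell_def xnode_def ynode_def gx_shift gy_shift)

lemma quad_sum_cancel:
  assumes "\<And>\<kappa> \<alpha> \<sigma> \<mu>. \<kappa> \<in> {1, 2} \<Longrightarrow> \<sigma> \<in> {1, 2} \<Longrightarrow> \<alpha> \<in> {1..ngauss G} \<Longrightarrow> \<mu> \<in> {1..ngauss G} \<Longrightarrow>
     f (xnode G a \<kappa> \<alpha>, ynode G b \<sigma> \<mu>) = - g (xnode G a \<kappa> \<alpha>, ynode G b \<sigma> \<mu>)"
  shows "quad_sum G a b f = - quad_sum G a b g"
proof -
  have "quad_sum G a b f = quad_sum G a b (\<lambda>z. - g z)"
    unfolding quad_sum_def
    by (intro arg_cong[where f = "\<lambda>x. _ *\<^sub>R x"] sum.cong refl) (simp only: assms)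
  also have "\<dots> = - quad_sum G a b g"
    by (simp only: quad_sum_def scaleR_minus_right sum_negf)
  finally show ?thesis .
qed

lemma delta_scaleR:
  assumes "hx G > 0" and "hy G > 0" and "\<And>z. z \<in> closed_cell G a b \<Longrightarrow> f z = g z *\<^sub>R e"
  shows "delta_x G a b f = delta_x G a b g *\<^sub>R e" and "delta_y G a b f = delta_y G a b g *\<^sub>R e"
  unfolding delta_x_def delta_y_def scaleR_sum_left
  by (intro sum.cong refl; simp add: assms quadrature_points scaleR_diff_left algebra_simps)+

text \<open>
  After the reduction to the projected pressure, flux and source are the same point values with
  opposite signs, in the sums over the nodes and in the sums over the edges.
\<close>

lemma scheme_form_hydrostatic:
  assumes "hx G > 0" and "hy G > 0" and "deg G \<ge> 2" and "gam G > 1"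
    and st: "(a, b) \<in> stencil_cells G \<Omega> A"
    and \<rho>s: "set_integrable lborel \<Omega> \<rho>s" "\<And>z. z \<in> \<Omega> \<Longrightarrow> \<rho>s z > 0"
    and ps: "set_integrable lborel \<Omega> ps"
    and nonzero: "\<And>\<kappa> \<alpha> \<sigma> \<mu>. \<kappa> \<in> {1, 2} \<Longrightarrow> \<sigma> \<in> {1, 2} \<Longrightarrow> \<alpha> \<in> {1..ngauss G} \<Longrightarrow> \<mu> \<in> {1..ngauss G} \<Longrightarrow>
       proj G (other A) \<rho>s (xnode G a \<kappa> \<alpha>, ynode G b \<sigma> \<mu>) \<noteq> 0"
  shows "scheme_form G A \<rho>s ps (Ush G A \<rho>s ps) (Ush G (other A) \<rho>s ps) a b v = 0"
proof -
  let ?U = "Ush G (other A) \<rho>s ps" and ?UA = "Ush G A \<rho>s ps"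
  let ?\<rho> = "proj G (other A) \<rho>s" and ?p = "proj G (other A) ps"
  note comps = Ush_components[OF assms(1-3), of "other A" \<rho>s ps]
  have Q: "Qmat (?U z) = ?\<rho> z *\<^sub>R momentum_embedding" for z
    using Qmat_rest[of "?U z"] comps by simp
  have avg: "cell_avg G a b (\<lambda>z. Qmat (?U z)) = cell_avg G a b ?\<rho> *\<^sub>R momentum_embedding"
    using proj_other_mesh_integral_pos(1)[OF assms(1-3) st \<rho>s]
    unfolding Q cell_avg_def set_lebesgue_integral_def set_integrable_def scaleR_scaleR
    by (subst scaleR_scaleR[symmetric]) (simp add: integral_scaleR_left)
  have "cell_avg G a b ?\<rho> > 0"
    using proj_other_mesh_integral_pos(2)[OF assms(1-3) st \<rho>s] assms(1,2) by (simp add: cell_avg_def)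
  then have R: "(1 / cell_avg G a b ?\<rho>) *\<^sub>R cell_avg G a b (\<lambda>z. Qmat (?U z)) = momentum_embedding"
    by (simp add: avg)
  have p: "(gam G - 1) * ?U z $ 4 = ?p z" if "z \<in> closed_cell G a b" for z
    using proj_scale[OF assms(1-3) st ps that, of "1 / (gam G - 1)"] assms(4) comps(4) by simp
  have F: "flux1 (gam G) (?U z) = ?p z *\<^sub>R e2" "flux2 (gam G) (?U z) = ?p z *\<^sub>R e3"
    if "z \<in> closed_cell G a b" for z
    using flux_rest[of "?U z" "gam G"] comps p[OF that] by simp_all
  have relaxation: "(LINT z:cell G a b|lborel. v z *\<^sub>R (?U z - ?UA z)) = - (LINT z:cell G a b|lborel. v z *\<^sub>R (?UA z - ?U z))"
  proof -
    have "v z *\<^sub>R (?U z - ?UA z) = - (v z *\<^sub>R (?UA z - ?U z))" for z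
      by (simp add: algebra_simps)
    then show ?thesis
      by (simp only: set_lebesgue_integral_def scaleR_minus_right integral_minus)
  qed
  \<comment> \<open>The bracket multiplying \<open>v \<nabla>p\<close> vanishes at the nodes, since \<open>\<rho>\<close> is not zero there.\<close>
  have volume: "quad_sum G a b (\<lambda>z. ((1 / ?\<rho> z) *\<^sub>R Qmat (?U z) - momentum_embedding) *v (v z *\<^sub>R grad ?p z) - momentum_embedding *v (?p z *\<^sub>R grad v z))
     = - quad_sum G a b (\<lambda>z. partial_x v z *\<^sub>R flux1 (gam G) (?U z) + partial_y v z *\<^sub>R flux2 (gam G) (?U z))"
    by (rule quad_sum_cancel)
       (simp add: Q nonzero F quadrature_points(1) assms(1,2) momentum_embedding_mult grad_def vector_2 mult.commute)
  have edge_x: "delta_x G a b (\<lambda>z. v z *\<^sub>R flux1 (gam G) (?U z)) = delta_x G a b (\<lambda>z. ?p z * v z) *\<^sub>R e2"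
    by (rule delta_scaleR(1)) (simp_all add: assms F mult.commute)
  have edge_y: "delta_y G a b (\<lambda>z. v z *\<^sub>R flux2 (gam G) (?U z)) = delta_y G a b (\<lambda>z. ?p z * v z) *\<^sub>R e3"
    by (rule delta_scaleR(2)) (simp_all add: assms F mult.commute)
  show ?thesis
    unfolding scheme_form_def source_form_def Let_def R volume edge_x edge_y relaxation
    by (simp add: momentum_embedding_mult vector_2)
qed


section \<open>The operator on a cell\<close>

lemma basis_fun_in_polys:
  assumes "hx G > 0" and "hy G > 0" and "m \<in> total_degree_pairs k"
  shows "basis_fun G a b m \<in> polys k"
proof -
  have "basis_fun G a b m z = (\<Sum>l\<in>total_degree_pairs k. (if l = m then 1 else 0) * basis_fun G a b l z)" for z
    using assms(3) by (simp add: if_distrib[of "\<lambda>x. x * _"] cong: if_cong)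
  then have "\<exists>c. \<forall>z. basis_fun G a b m z = (\<Sum>l\<in>total_degree_pairs k. c l * basis_fun G a b l z)"
    by (intro exI[of _ "\<lambda>l. if l = m then 1 else 0"]) blast
  then show ?thesis
    using assms by (subst polys_basis_expansion[of G _ k a b]) auto
qed

lemma polys_orthogonal_imp_zero:
  assumes "hx G > 0" and "hy G > 0" and "q \<in> polys k"
    and "\<And>v. v \<in> polys k \<Longrightarrow> (LINT z:cell G a b|lborel. v z * q z) = 0"
  shows "q z = 0"
proof -
  obtain c where c: "\<And>z. q z = (\<Sum>l\<in>total_degree_pairs k. c l * basis_fun G a b l z)"
    using polys_basis_expansion[of G q k a b] assms by auto
  have "c m = 0" if m: "m \<in> total_degree_pairs k" for m
  proof -
    have "(LINT z:cell G a b|lborel. q z * basis_fun G a b m z) = 0"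
      using assms(4)[OF basis_fun_in_polys[OF assms(1,2) m]] by (simp add: mult.commute)
    then have "c m * (LINT z:cell G a b|lborel. basis_fun G a b m z * basis_fun G a b m z) = 0"
      using basis_coefficient[OF assms(1,2) finite_total_degree_pairs m, of a b c] by (simp add: c)
    then show ?thesis
      using basis_fun_orthogonal[OF assms(1,2)] by simp
  qed
  then show ?thesis by (simp add: c)
qed

text \<open>
  The Bochner integral of a vector is taken componentwise only once the vector function is known to be
  integrable; this is recovered from its components through the standard basis.
\<close>

lemma set_integral_component:
  fixes f :: "'a \<Rightarrow> real^'n"
  assumes "\<And>i. set_integrable M S (\<lambda>z. f z $ i)"
  shows "(LINT z:S|M. f z) $ i = (LINT z:S|M. f z $ i)"
proof -
  have eq: "indicator S z *\<^sub>R f z = (\<Sum>j\<in>UNIV. (indicator S z *\<^sub>R f z $ j) *\<^sub>R axis j 1)" for z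
    by (simp add: vec_eq_iff axis_def if_distrib cong: if_cong)
  have "integrable M (\<lambda>z. indicator S z *\<^sub>R f z)"
    unfolding eq
    by (intro Bochner_Integration.integrable_sum integrable_scaleR_left) (use assms in \<open>simp add: set_integrable_def\<close>)
  then have "(LINT z|M. (indicator S z *\<^sub>R f z) $ i) = (LINT z|M. indicator S z *\<^sub>R f z) $ i"
    by (rule integral_bounded_linear[OF bounded_linear_vec_nth])
  then show ?thesis
    by (simp add: set_lebesgue_integral_def)
qed

lemma zero_in_polys: "(\<lambda>z. 0) \<in> polys k"
  unfolding polys_def by (intro CollectI exI[of _ "\<lambda>i j. 0"]) simp

lemma polys_mult_integrable:
  assumes "hx G > 0" and "hy G > 0" and "v \<in> polys k" and "q \<in> polys k"
  shows "set_integrable lborel (cell G a b) (\<lambda>z. v z * q z)"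
proof (rule set_integrable_mult_bounded)
  obtain c where "\<And>z. q z = (\<Sum>l\<in>total_degree_pairs k. c l * basis_fun G a b l z)"
    using polys_basis_expansion[of G q k a b] assms by auto
  then have "q = (\<lambda>z. \<Sum>l\<in>total_degree_pairs k. c l * basis_fun G a b l z)"
    by (rule ext)
  then show "continuous_on UNIV q"
    by (auto intro!: continuous_intros)
qed (use assms in \<open>auto intro: integrable_polys\<close>)

lemma Lh_cell_zero:
  assumes "hx G > 0" and "hy G > 0"
    and zero: "\<And>v. v \<in> polys (deg G) \<Longrightarrow> scheme_form G A \<rho>s ps UA UB a b v = 0"
  shows "Lh_cell G A \<rho>s ps UA UB a b = (\<lambda>z. 0)"
  unfolding Lh_cell_def
proof (rule the_equality)
  show "(\<forall>i. (\<lambda>z. 0 $ i) \<in> polys (deg G)) \<and>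
     (\<forall>v\<in>polys (deg G). (LINT z:cell G a b|lborel. v z *\<^sub>R 0) = scheme_form G A \<rho>s ps UA UB a b v)"
    using zero by (simp add: zero_in_polys set_lebesgue_integral_def)
next
  fix q :: "real \<times> real \<Rightarrow> real^4"
  assume q: "(\<forall>i. (\<lambda>z. q z $ i) \<in> polys (deg G)) \<and>
     (\<forall>v\<in>polys (deg G). (LINT z:cell G a b|lborel. v z *\<^sub>R q z) = scheme_form G A \<rho>s ps UA UB a b v)"
  have "q z $ i = 0" for z i
  proof (rule polys_orthogonal_imp_zero[OF assms(1,2), of "\<lambda>z. q z $ i"])
    show "(\<lambda>z. q z $ i) \<in> polys (deg G)"
      using q by blast
    fix v assume v: "v \<in> polys (deg G)"
    then have "(LINT z:cell G a b|lborel. v z *\<^sub>R q z) = 0"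
      using q zero by simp
    moreover have "(LINT z:cell G a b|lborel. v z *\<^sub>R q z) $ i = (LINT z:cell G a b|lborel. (v z *\<^sub>R q z) $ i)"
      by (rule set_integral_component) (use q v polys_mult_integrable[OF assms(1,2) v] in simp)
    ultimately show "(LINT z:cell G a b|lborel. v z * q z $ i) = 0"
      by simp
  qed
  then show "q = (\<lambda>z. 0)"
    by (simp add: fun_eq_iff vec_eq_iff)
qed

theorem theorem4p1:
  fixes G :: cdg
    and \<Omega> :: "(real \<times> real) set"
    and lo up :: "real \<times> real"
    and \<phi> \<rho>s ps :: "real \<times> real \<Rightarrow> real"
  assumes "hx G > 0" and "hy G > 0" and "tmax G > 0" and "gam G > 1"
    and "deg G \<ge> 2" and "ngauss G \<ge> deg G + 1"
    and "\<Omega> = box lo up"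
    and "hydrostatic \<Omega> \<phi> \<rho>s ps"
    and "L2_on \<Omega> \<rho>s" and "L2_on \<Omega> ps"
    and "\<And>A a b \<kappa> \<alpha> \<sigma> \<mu>.
           (a, b) \<in> stencil_cells G \<Omega> A \<Longrightarrow> \<kappa> \<in> {1, 2} \<Longrightarrow> \<sigma> \<in> {1, 2} \<Longrightarrow>
           \<alpha> \<in> {1..ngauss G} \<Longrightarrow> \<mu> \<in> {1..ngauss G} \<Longrightarrow>
           proj G (other A) \<rho>s (xnode G a \<kappa> \<alpha>, ynode G b \<sigma> \<mu>) \<noteq> 0"
  shows "(\<forall>(a, b) \<in> stencil_cells G \<Omega> C. \<forall>z \<in> cell G a b.
            Lh G C \<rho>s ps (Ush G C \<rho>s ps) (Ush G D \<rho>s ps) z = 0) \<and>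
         (\<forall>(a, b) \<in> stencil_cells G \<Omega> D. \<forall>z \<in> cell G a b.
            Lh G D \<rho>s ps (Ush G D \<rho>s ps) (Ush G C \<rho>s ps) z = 0)"
proof -
  have balance: "Lh G A \<rho>s ps (Ush G A \<rho>s ps) (Ush G (other A) \<rho>s ps) z = 0"
    if st: "(a, b) \<in> stencil_cells G \<Omega> A" and z: "z \<in> cell G a b" for A a b z
  proof -
    have "scheme_form G A \<rho>s ps (Ush G A \<rho>s ps) (Ush G (other A) \<rho>s ps) a b v = 0" for v
    proof (rule scheme_form_hydrostatic[OF assms(1,2,5,4) st])
      show "set_integrable lborel \<Omega> \<rho>s" "set_integrable lborel \<Omega> ps"
        using assms(7,9,10) by (auto intro: L2_on_imp_integrable)
      show "\<rho>s z > 0" if "z \<in> \<Omega>" for z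
        using assms(8) that by (auto simp: hydrostatic_def)
    qed (rule assms(11)[OF st])
    then have "Lh_cell G A \<rho>s ps (Ush G A \<rho>s ps) (Ush G (other A) \<rho>s ps) a b = (\<lambda>z. 0)"
      by (intro Lh_cell_zero assms)
    moreover have "(a, b) \<in> mesh A"
      using st by (simp add: stencil_cells_def)
    ultimately show ?thesis
      unfolding Lh_def by (subst piecewise_in_cell[OF assms(1,2) _ z]) simp_all
  qed
  show ?thesis
    using balance[of _ _ C] balance[of _ _ D] by auto
qed

end
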